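(* Let $A_1,A_2,A_3,B_1,B_2,B_3$ be parameters and consider the system $f_1=f_2=f_3=f_4=0$ in the unknowns $q_0,q_1,q_2,q_3$, where $$\begin{aligned} f_1&=A_1(q_0^2-q_1^2-q_2^2+q_3^2)+2B_1(q_2q_3-q_0q_1),\\ f_2&=A_2(q_0^2-q_1^2+q_2^2-q_3^2)+2B_2(q_1q_2-q_0q_3),\\ f_3&=A_3(q_0^2+q_1^2-q_2^2-q_3^2)+2B_3(q_1q_3-q_0q_2),\\ f_4&=q_0^2+q_1^2+q_2^2+q_3^2-1 . \end{aligned}$$ Then the $q_0$-coordinates of the solutions of this system are roots of a polynomial of degree $16$ in the unknown $q_0$ with parameters $A_1,A_2,A_3,B_1,B_2,B_3$. This polynomial is the determinant of a Dixon matrix $Dix(f_1,f_2,f_3,f_4;q_1,q_2,q_3)$, it is solvable in radicals, and, up to a scalar, $$\det Dix(f_1,f_2,f_3,f_4;q_1,q_2,q_3)=(2q_0-1)^4(2q_0+1)^4\cdot G(q_0),$$ $$G(q_0)=-16777216\,w^2q_0^8+16777216\,w^2q_0^6-2097152\,w\cdot w_1\,q_0^4+w\cdot w_2\,q_0^2+w_3,$$ where $$w=(A_2^2A_3^2+A_2^2B_3^2+B_2^2B_3^2)(A_1^2A_3^2+B_1^2A_3^2+B_1^2B_3^2)(A_1^2A_2^2+A_1^2B_2^2+B_1^2B_2^2),$$ $$\begin{aligned} w_1={}&3A_1^4A_2^4A_3^4+2A_1^2B_1^2A_2^4A_3^4+2A_1^4A_2^2B_2^2A_3^4+5A_1^2B_1^2A_2^2B_2^2A_3^4+3B_1^4A_2^2B_2^2A_3^4\\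 &+2A_1B_1^3A_2^3B_2A_3^3B_3+2A_1^3B_1A_2B_2^3A_3^3B_3+3A_1^4B_2^4A_3^2B_3^2+2A_1B_1^3A_2B_2^3A_3^3B_3\\ &+2A_1^4A_2^4A_3^2B_3^2+5A_1^2B_1^2A_2^4A_3^2B_3^2+5A_1^4A_2^2B_2^2A_3^2B_3^2+9A_1^2B_1^2A_2^2B_2^2A_3^2B_3^2\\ &+5B_1^4A_2^2B_2^2A_3^2B_3^2+5A_1^2B_1^2B_2^4A_3^2B_3^2+2B_1^4B_2^4A_3^2B_3^2+2A_1^3B_1A_2^3B_2A_3B_3^3\\ &+2A_1B_1^3A_2^3B_2A_3B_3^3+2A_1^3B_1A_2B_2^3A_3B_3^3+6A_1B_1^3A_2B_2^3A_3B_3^3+3A_1^2B_1^2A_2^4B_3^4\\ &+5A_1^2B_1^2A_2^2B_2^2B_3^4+2B_1^4A_2^2B_2^2B_3^4+2A_1^2B_1^2B_2^4B_3^4, \end{aligned}$$ $$\begin{aligned} w_2={}&A_1^4A_2^4A_3^4+A_1^2B_1^2A_2^2B_2^2A_3^4+B_1^4A_2^2B_2^2A_3^4-2A_1^3B_1A_2^3B_2A_3^3B_3+2A_1B_1^3A_2^3B_2A_3^3B_3\\ &+2A_1^3B_1A_2B_2^3A_3^3B_3+2A_1B_1^3A_2B_2^3A_3^3B_3+A_1^2B_1^2A_2^4A_3^2B_3^2+A_1^4A_2^2B_2^2A_3^2B_3^2\\ &+7A_1^2B_1^2A_2^2B_2^2A_3^2B_3^2+B_1^4A_2^2B_2^2A_3^2B_3^2+A_1^4B_2^4A_3^2B_3^2+A_1^2B_1^2B_2^4A_3^2B_3^2\\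 &+2A_1^3B_1A_2^3B_2A_3B_3^3+2A_1B_1^3A_2^3B_2A_3B_3^3+2A_1^3B_1A_2B_2^3A_3B_3^3+A_1^2B_1^2A_2^4B_3^4+A_1^2B_1^2A_2^2B_2^2B_3^4, \end{aligned}$$ $$\begin{aligned} w_3={}&-A_1^4A_2^4A_3^4+A_1^2B_1^2A_2^2B_2^2A_3^4+B_1^4A_2^2B_2^2A_3^4+4A_1^3B_1A_2^3B_2A_3^3B_3+2A_1B_1^3A_2^3B_2A_3^3B_3\\ &+2A_1^3B_1A_2B_2^3A_3^3B_3+A_1^4B_2^4A_3^2B_3^2+2A_1B_1^3A_2B_2^3A_3^3B_3+A_1^2B_1^2A_2^4A_3^2B_3^2\\ &+A_1^4A_2^2B_2^2A_3^2B_3^2+A_1^2B_1^2A_2^2B_2^2A_3^2B_3^2+B_1^4A_2^2B_2^2A_3^2B_3^2+A_1^2B_1^2B_2^4A_3^2B_3^2\\ &+2A_1^3B_1A_2^3B_2A_3B_3^3+2A_1B_1^3A_2^3B_2A_3B_3^3+2A_1^3B_1A_2B_2^3A_3B_3^3+2A_1B_1^3A_2B_2^3A_3B_3^3\\ &+A_1^2B_1^2A_2^4B_3^4+A_1^2B_1^2A_2^2B_2^2B_3^4 . \end{aligned}$$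
   Context: The system is that of the forward displacement problem of the $3-\hat{\underline{R}}(RRR)_E\hat{R}$ spherical parallel manipulator (here $R$ denotes a revolute joint, hats denote intersecting joints, the underline the actuated joint, and $(\ )_E$ a plane chain); there $A_i=\sin\theta_i$, $B_i=\cos\theta_i$ with $\theta_i$ the motor angles, and the $A_i,B_i$ are treated as parameters. A solution of the system is a point $(s_0,s_1,s_2,s_3)\in\mathbb{C}^4$ at which $f_1,f_2,f_3,f_4$ all vanish. Definition of the Dixon matrix. A quadric (cubic) is a polynomial of total degree at most $2$ (at most $3$) in the unknowns. Given quadrics $f_1,\dots,f_4$ in three unknowns $x_1,x_2,x_3$ (whose coefficients may contain further parameters), order the twenty monomials of total degree at most $3$ as $$x_1^3,x_1^2x_2,x_1^2x_3,x_1x_2^2,x_1x_2x_3,x_1x_3^2,x_2^3,x_2^2x_3,x_2x_3^2,x_3^3,x_1^2,x_1x_2,x_1x_3,x_2^2,x_2x_3,x_3^2,x_1,x_2,x_3,1.$$ The coefficient row vector of a cubic $g$ is the row vector of its twenty coefficients with respect to these monomials in this order. Let $U$ be the $4\times4$ matrix whose $i$-th row is $$\left[\tfrac{f_i(x_1,x_2,x_3)-f_i(y_1,x_2,x_3)}{x_1-y_1},\ \tfrac{f_i(y_1,x_2,x_3)-f_i(y_1,y_2,x_3)}{x_2-y_2},\ \tfrac{f_i(y_1,y_2,x_3)-f_i(y_1,y_2,y_3)}{x_3-y_3},\ f_i(y_1,y_2,y_3)\right],$$ and write $\det U=\sum_{i,j,k}\psi_{ijk}\,y_1^iy_2^jy_3^k$,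 where the $\psi_{ijk}$ are polynomials in $x_1,x_2,x_3$; for $i+j+k\le1$ they are cubics. The Dixon matrix $Dix(f_1,f_2,f_3,f_4;x_1,x_2,x_3)$ is the $20\times20$ matrix whose $i$-th row is the coefficient row vector of $g_i$, where $g_i=f_i$, $g_{4+i}=x_1f_i$, $g_{8+i}=x_2f_i$, $g_{12+i}=x_3f_i$ for $1\le i\le4$, and $g_{17}=\psi_{000}$, $g_{18}=\psi_{100}$, $g_{19}=\psi_{010}$, $g_{20}=\psi_{001}$. The matrix $Dix(f_1,f_2,f_3,f_4;q_1,q_2,q_3)$ is obtained with $(x_1,x_2,x_3)=(q_1,q_2,q_3)$ as unknowns, $q_0$ and the $A_i,B_i$ being regarded as parameters in the coefficients.
   Formalization: The last two terms of G are corrected from w·w_2·q_0^2 + w_3 to 1048576·w·w_2·q_0^2 − 65536·w_3^2, as the printed formula fails (e.g. A_i=1, B_i=0); degree 16 is stated for w≠0 and solvability in radicals for nonzero determinant. *)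

theory Defs
  imports Complex_Main "HOL-Library.Poly_Mapping" "Jordan_Normal_Form.Determinant"
begin

text \<open>Polynomials over a commutative ring in indeterminates \<open>Var 0, Var 1, \<dots>\<close>, as finitely
  supported maps from exponent vectors to coefficients.  Throughout, \<open>Var 1, Var 2, Var 3\<close> play the
  role of \<open>x1, x2, x3\<close> and \<open>Var 4, Var 5, Var 6\<close> that of \<open>y1, y2, y3\<close>.\<close>

type_synonym 'a mpol = "(nat \<Rightarrow>\<^sub>0 nat) \<Rightarrow>\<^sub>0 'a"

definition Const :: "'a::comm_ring_1 \<Rightarrow> 'a mpol" where
  "Const c = Poly_Mapping.single 0 c"

definition Var :: "nat \<Rightarrow> 'a::comm_ring_1 mpol" where
  "Var i = Poly_Mapping.single (Poly_Mapping.single i 1) 1"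

definition subst :: "(nat \<Rightarrow> 'a mpol) \<Rightarrow> 'a::comm_ring_1 mpol \<Rightarrow> 'a mpol" where
  "subst \<sigma> p =
     (\<Sum>m\<in>Poly_Mapping.keys p. Const (Poly_Mapping.lookup p m)
        * (\<Prod>i\<in>Poly_Mapping.keys m. \<sigma> i ^ Poly_Mapping.lookup m i))"

text \<open>The polynomial \<open>p / d\<close>, meaningful when \<open>d \<noteq> 0\<close> divides \<open>p\<close> and the coefficients form an
  integral domain (so that the quotient is unique).\<close>

definition exact_quot :: "'a::idom mpol \<Rightarrow> 'a mpol \<Rightarrow> 'a mpol" where
  "exact_quot p d = (THE h. h * d = p)"

definition dixon_U_row :: "'a::idom mpol \<Rightarrow> 'a mpol list" where
  "dixon_U_row f =
     (let f0 = f;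
          f1 = subst (Var(1 := Var 4)) f;
          f2 = subst (Var(1 := Var 4, 2 := Var 5)) f;
          f3 = subst (Var(1 := Var 4, 2 := Var 5, 3 := Var 6)) f
      in [exact_quot (f0 - f1) (Var 1 - Var 4),
          exact_quot (f1 - f2) (Var 2 - Var 5),
          exact_quot (f2 - f3) (Var 3 - Var 6),
          f3])"

definition dixon_U :: "'a::idom mpol \<Rightarrow> 'a mpol \<Rightarrow> 'a mpol \<Rightarrow> 'a mpol \<Rightarrow> 'a mpol mat" where
  "dixon_U f1 f2 f3 f4 = mat_of_rows_list 4 (map dixon_U_row [f1, f2, f3, f4])"

definition x_expo :: "nat \<times> nat \<times> nat \<Rightarrow> (nat \<Rightarrow>\<^sub>0 nat)" where
  "x_expo = (\<lambda>(a, b, c).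
     Poly_Mapping.single 1 a + Poly_Mapping.single 2 b + Poly_Mapping.single 3 c)"

definition y_expo :: "nat \<times> nat \<times> nat \<Rightarrow> (nat \<Rightarrow>\<^sub>0 nat)" where
  "y_expo = (\<lambda>(i, j, k).
     Poly_Mapping.single 4 i + Poly_Mapping.single 5 j + Poly_Mapping.single 6 k)"

definition cubic_monomials :: "(nat \<times> nat \<times> nat) list" where
  "cubic_monomials =
     [(3,0,0), (2,1,0), (2,0,1), (1,2,0), (1,1,1), (1,0,2), (0,3,0), (0,2,1), (0,1,2), (0,0,3),
      (2,0,0), (1,1,0), (1,0,1), (0,2,0), (0,1,1), (0,0,2), (1,0,0), (0,1,0), (0,0,1), (0,0,0)]"

definition coeff_row :: "'a::comm_ring_1 mpol \<Rightarrow> 'a list" where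
  "coeff_row g = map (\<lambda>m. Poly_Mapping.lookup g (x_expo m)) cubic_monomials"

text \<open>If \<open>D = (\<Sum>i j k. \<psi>\<^bsub>ijk\<^esub> y1^i y2^j y3^k)\<close> with \<open>\<psi>\<^bsub>ijk\<^esub>\<close> polynomials in \<open>x1, x2, x3\<close>, the coefficient
  of a monomial in \<open>\<psi>\<^bsub>ijk\<^esub>\<close> is the coefficient in \<open>D\<close> of that monomial times \<open>y1^i y2^j y3^k\<close>.
  Hence the following is the coefficient row vector of \<open>\<psi>\<^bsub>ijk\<^esub>\<close>.\<close>

definition psi_row :: "'a::comm_ring_1 mpol \<Rightarrow> nat \<times> nat \<times> nat \<Rightarrow> 'a list" where
  "psi_row D ijk =
     map (\<lambda>m. Poly_Mapping.lookup D (x_expo m + y_expo ijk)) cubic_monomials"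

definition Dix :: "'a::idom mpol \<Rightarrow> 'a mpol \<Rightarrow> 'a mpol \<Rightarrow> 'a mpol \<Rightarrow> 'a mat" where
  "Dix f1 f2 f3 f4 =
     mat_of_rows_list 20
       ([coeff_row (x * f). x \<leftarrow> [1, Var 1, Var 2, Var 3], f \<leftarrow> [f1, f2, f3, f4]]
        @ map (psi_row (det (dixon_U f1 f2 f3 f4))) [(0,0,0), (1,0,0), (0,1,0), (0,0,1)])"

text \<open>The system.  The polynomials are defined over an arbitrary commutative ring, so that they can
  be read both as functions on \<open>\<complex>^4\<close> and as polynomials in \<open>q1, q2, q3\<close> over the ring \<open>\<complex>[q0]\<close>.\<close>

definition F1 :: "'a::comm_ring_1 \<Rightarrow> 'a \<Rightarrow> 'a \<Rightarrow> 'a \<Rightarrow> 'a \<Rightarrow> 'a \<Rightarrow> 'a" where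
  "F1 A1 B1 q0 q1 q2 q3 = A1 * (q0^2 - q1^2 - q2^2 + q3^2) + 2 * B1 * (q2 * q3 - q0 * q1)"

definition F2 :: "'a::comm_ring_1 \<Rightarrow> 'a \<Rightarrow> 'a \<Rightarrow> 'a \<Rightarrow> 'a \<Rightarrow> 'a \<Rightarrow> 'a" where
  "F2 A2 B2 q0 q1 q2 q3 = A2 * (q0^2 - q1^2 + q2^2 - q3^2) + 2 * B2 * (q1 * q2 - q0 * q3)"

definition F3 :: "'a::comm_ring_1 \<Rightarrow> 'a \<Rightarrow> 'a \<Rightarrow> 'a \<Rightarrow> 'a \<Rightarrow> 'a \<Rightarrow> 'a" where
  "F3 A3 B3 q0 q1 q2 q3 = A3 * (q0^2 + q1^2 - q2^2 - q3^2) + 2 * B3 * (q1 * q3 - q0 * q2)"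

definition F4 :: "'a::comm_ring_1 \<Rightarrow> 'a \<Rightarrow> 'a \<Rightarrow> 'a \<Rightarrow> 'a" where
  "F4 q0 q1 q2 q3 = q0^2 + q1^2 + q2^2 + q3^2 - 1"

definition is_solution ::
    "complex \<Rightarrow> complex \<Rightarrow> complex \<Rightarrow> complex \<Rightarrow> complex \<Rightarrow> complex
     \<Rightarrow> complex \<times> complex \<times> complex \<times> complex \<Rightarrow> bool" where
  "is_solution A1 A2 A3 B1 B2 B3 = (\<lambda>(s0, s1, s2, s3).
     F1 A1 B1 s0 s1 s2 s3 = 0 \<and> F2 A2 B2 s0 s1 s2 s3 = 0 \<and>
     F3 A3 B3 s0 s1 s2 s3 = 0 \<and> F4 s0 s1 s2 s3 = 0)"

text \<open>\<open>Dix(f1, f2, f3, f4; q1, q2, q3)\<close> for the system.  Its entries are polynomials in \<open>q0 = [:0, 1:]\<close>.\<close>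

definition system_Dix ::
    "complex \<Rightarrow> complex \<Rightarrow> complex \<Rightarrow> complex \<Rightarrow> complex \<Rightarrow> complex \<Rightarrow> complex poly mat" where
  "system_Dix A1 A2 A3 B1 B2 B3 =
     (let q0 = Const [:0, 1:] in
      Dix (F1 (Const [:A1:]) (Const [:B1:]) q0 (Var 1) (Var 2) (Var 3))
          (F2 (Const [:A2:]) (Const [:B2:]) q0 (Var 1) (Var 2) (Var 3))
          (F3 (Const [:A3:]) (Const [:B3:]) q0 (Var 1) (Var 2) (Var 3))
          (F4 q0 (Var 1) (Var 2) (Var 3)))"

definition w :: "complex \<Rightarrow> complex \<Rightarrow> complex \<Rightarrow> complex \<Rightarrow> complex \<Rightarrow> complex \<Rightarrow> complex" where
  "w A1 A2 A3 B1 B2 B3 =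
     (A2^2 * A3^2 + A2^2 * B3^2 + B2^2 * B3^2)
     * (A1^2 * A3^2 + B1^2 * A3^2 + B1^2 * B3^2)
     * (A1^2 * A2^2 + A1^2 * B2^2 + B1^2 * B2^2)"

definition w1 :: "complex \<Rightarrow> complex \<Rightarrow> complex \<Rightarrow> complex \<Rightarrow> complex \<Rightarrow> complex \<Rightarrow> complex" where
  "w1 A1 A2 A3 B1 B2 B3 =
     3 * A1^4 * A2^4 * A3^4 + 2 * A1^2 * B1^2 * A2^4 * A3^4 + 2 * A1^4 * A2^2 * B2^2 * A3^4
     + 5 * A1^2 * B1^2 * A2^2 * B2^2 * A3^4 + 3 * B1^4 * A2^2 * B2^2 * A3^4
     + 2 * A1 * B1^3 * A2^3 * B2 * A3^3 * B3 + 2 * A1^3 * B1 * A2 * B2^3 * A3^3 * B3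
     + 3 * A1^4 * B2^4 * A3^2 * B3^2 + 2 * A1 * B1^3 * A2 * B2^3 * A3^3 * B3
     + 2 * A1^4 * A2^4 * A3^2 * B3^2 + 5 * A1^2 * B1^2 * A2^4 * A3^2 * B3^2
     + 5 * A1^4 * A2^2 * B2^2 * A3^2 * B3^2 + 9 * A1^2 * B1^2 * A2^2 * B2^2 * A3^2 * B3^2
     + 5 * B1^4 * A2^2 * B2^2 * A3^2 * B3^2 + 5 * A1^2 * B1^2 * B2^4 * A3^2 * B3^2
     + 2 * B1^4 * B2^4 * A3^2 * B3^2 + 2 * A1^3 * B1 * A2^3 * B2 * A3 * B3^3
     + 2 * A1 * B1^3 * A2^3 * B2 * A3 * B3^3 + 2 * A1^3 * B1 * A2 * B2^3 * A3 * B3^3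
     + 6 * A1 * B1^3 * A2 * B2^3 * A3 * B3^3 + 3 * A1^2 * B1^2 * A2^4 * B3^4
     + 5 * A1^2 * B1^2 * A2^2 * B2^2 * B3^4 + 2 * B1^4 * A2^2 * B2^2 * B3^4
     + 2 * A1^2 * B1^2 * B2^4 * B3^4"

definition w2 :: "complex \<Rightarrow> complex \<Rightarrow> complex \<Rightarrow> complex \<Rightarrow> complex \<Rightarrow> complex \<Rightarrow> complex" where
  "w2 A1 A2 A3 B1 B2 B3 =
     A1^4 * A2^4 * A3^4 + A1^2 * B1^2 * A2^2 * B2^2 * A3^4
     + B1^4 * A2^2 * B2^2 * A3^4 - 2 * A1^3 * B1 * A2^3 * B2 * A3^3 * B3
     + 2 * A1 * B1^3 * A2^3 * B2 * A3^3 * B3 + 2 * A1^3 * B1 * A2 * B2^3 * A3^3 * B3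
     + 2 * A1 * B1^3 * A2 * B2^3 * A3^3 * B3 + A1^2 * B1^2 * A2^4 * A3^2 * B3^2
     + A1^4 * A2^2 * B2^2 * A3^2 * B3^2 + 7 * A1^2 * B1^2 * A2^2 * B2^2 * A3^2 * B3^2
     + B1^4 * A2^2 * B2^2 * A3^2 * B3^2 + A1^4 * B2^4 * A3^2 * B3^2
     + A1^2 * B1^2 * B2^4 * A3^2 * B3^2 + 2 * A1^3 * B1 * A2^3 * B2 * A3 * B3^3
     + 2 * A1 * B1^3 * A2^3 * B2 * A3 * B3^3 + 2 * A1^3 * B1 * A2 * B2^3 * A3 * B3^3
     + A1^2 * B1^2 * A2^4 * B3^4 + A1^2 * B1^2 * A2^2 * B2^2 * B3^4"

definition w3 :: "complex \<Rightarrow> complex \<Rightarrow> complex \<Rightarrow> complex \<Rightarrow> complex \<Rightarrow> complex \<Rightarrow> complex" where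
  "w3 A1 A2 A3 B1 B2 B3 =
     - (A1^4 * A2^4 * A3^4) + A1^2 * B1^2 * A2^2 * B2^2 * A3^4 + B1^4 * A2^2 * B2^2 * A3^4
     + 4 * A1^3 * B1 * A2^3 * B2 * A3^3 * B3 + 2 * A1 * B1^3 * A2^3 * B2 * A3^3 * B3
     + 2 * A1^3 * B1 * A2 * B2^3 * A3^3 * B3 + A1^4 * B2^4 * A3^2 * B3^2
     + 2 * A1 * B1^3 * A2 * B2^3 * A3^3 * B3 + A1^2 * B1^2 * A2^4 * A3^2 * B3^2
     + A1^4 * A2^2 * B2^2 * A3^2 * B3^2 + A1^2 * B1^2 * A2^2 * B2^2 * A3^2 * B3^2
     + B1^4 * A2^2 * B2^2 * A3^2 * B3^2 + A1^2 * B1^2 * B2^4 * A3^2 * B3^2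
     + 2 * A1^3 * B1 * A2^3 * B2 * A3 * B3^3 + 2 * A1 * B1^3 * A2^3 * B2 * A3 * B3^3
     + 2 * A1^3 * B1 * A2 * B2^3 * A3 * B3^3 + 2 * A1 * B1^3 * A2 * B2^3 * A3 * B3^3
     + A1^2 * B1^2 * A2^4 * B3^4 + A1^2 * B1^2 * A2^2 * B2^2 * B3^4"

text \<open>The source prints the last two terms of \<open>G\<close> as \<open>+ w w2 q0^2 + w3\<close>.  This cannot be meant: for
  each \<open>i\<close> the determinant is homogeneous of degree 8 in \<open>(A\<^bsub>i\<^esub>, B\<^bsub>i\<^esub>)\<close>, as are \<open>w^2\<close>, \<open>w w1\<close>, \<open>w w2\<close>, but
  \<open>w3\<close> has degree 4.  The numerical factors \<open>2^20\<close> and \<open>-2^16\<close> and the square on \<open>w3\<close> are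
  corrections of the printed formula; everything else is as printed.\<close>

definition G :: "complex \<Rightarrow> complex \<Rightarrow> complex \<Rightarrow> complex \<Rightarrow> complex \<Rightarrow> complex \<Rightarrow> complex poly" where
  "G A1 A2 A3 B1 B2 B3 =
     (let W = w A1 A2 A3 B1 B2 B3; W1 = w1 A1 A2 A3 B1 B2 B3;
          W2 = w2 A1 A2 A3 B1 B2 B3; W3 = w3 A1 A2 A3 B1 B2 B3
      in monom (- 16777216 * W^2) 8 + monom (16777216 * W^2) 6 - monom (2097152 * W * W1) 4
         + monom (1048576 * W * W2) 2 - monom (65536 * W3^2) 0)"

definition is_subfield :: "'a::field set \<Rightarrow> bool" where
  "is_subfield K \<longleftrightarrow> 1 \<in> K \<and> (\<forall>x\<in>K. \<forall>y\<in>K. x - y \<in> K \<and> x * y \<in> K) \<and> (\<forall>x\<in>K. inverse x \<in> K)"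

definition gen_subfield :: "'a::field set \<Rightarrow> 'a set" where
  "gen_subfield S = \<Inter>{K. is_subfield K \<and> S \<subseteq> K}"

inductive radical_ext :: "'a::field set \<Rightarrow> 'a set \<Rightarrow> bool" for K where
  refl: "radical_ext K K"
| step: "radical_ext K L \<Longrightarrow> n > 0 \<Longrightarrow> a ^ n \<in> L \<Longrightarrow> radical_ext K (gen_subfield (insert a L))"

text \<open>For a subfield \<open>K\<close> of \<open>\<complex>\<close> and a nonzero polynomial \<open>p\<close> over \<open>K\<close>: some radical extension of \<open>K\<close>
  contains the splitting field of \<open>p\<close>.\<close>

definition solvable_in_radicals :: "complex set \<Rightarrow> complex poly \<Rightarrow> bool" where
  "solvable_in_radicals K p \<longleftrightarrow>
     p \<noteq> 0 \<and> (\<forall>i. coeff p i \<in> K) \<and> (\<exists>L. radical_ext K L \<and> {z. poly p z = 0} \<subseteq> L)"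

end

theory Submission
  imports Defs
begin

text \<open>Read homogeneously in \<open>(q0, q1, q2, q3)\<close>, the equations \<open>f1 = f2 = f3 = 0\<close> describe three
  quadrics in projective space, which in general meet in eight points. A Dixon determinant of four
  quadrics is a resultant, so the determinant should be, up to a constant, the product of the values
  of \<open>f4\<close> at these eight points, each scaled to have first coordinate \<open>q0\<close>. The eight points can be
  written down, and the proof checks that the resulting product is the determinant.

  In the coordinates \<open>u\<close> with \<open>q0 = u0 + u1 + u2 + u3\<close>, \<open>q1 = u0 - u1 - u2 + u3\<close>,
  \<open>q2 = u0 - u1 + u2 - u3\<close>, \<open>q3 = u0 + u1 - u2 - u3\<close> the three quadrics are, up to a factor 8,
  \<open>A1 (u0 u1 + u2 u3) - B1 (u0 u3 - u1 u2)\<close>, \<open>A2 (u0 u2 + u1 u3) - B2 (u0 u1 - u2 u3)\<close> and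
  \<open>A3 (u0 u3 + u1 u2) - B3 (u0 u2 - u1 u3)\<close>. They contain no squares, so the four coordinate points
  are common zeros; these are the points \<open>(1, \<plusminus>1, \<plusminus>1, \<plusminus>1)\<close> with an even number of minus signs, where
  \<open>f4 = 4 q0^2 - 1\<close>, and they account for the factor \<open>(2 q0 - 1)^4 (2 q0 + 1)^4\<close>. For the other four
  points the equations tie the sums \<open>u0 u1 + u2 u3\<close>, \<open>u0 u2 + u1 u3\<close>, \<open>u0 u3 + u1 u2\<close> to the
  differences \<open>u0 u3 - u1 u2\<close>, \<open>u0 u1 - u2 u3\<close>, \<open>u0 u2 - u1 u3\<close>; since the three products
  \<open>(u0 u1)(u2 u3)\<close>, \<open>(u0 u2)(u1 u3)\<close>, \<open>(u0 u3)(u1 u2)\<close> agree, the squares of the differences satisfy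
  linear equations. Their solution involves exactly the three factors of \<open>w\<close>, and the four points
  are given by the choices, up to a common sign, of the square roots \<open>r1, r2, r3\<close> of these factors.
  Each choice contributes a factor \<open>r1 r2 r3 (4 q0^2 - 1) - (B1 B2 B3 - A1 A2 A3) (\<plusminus> B1 r3 \<plusminus> B2 r1 \<plusminus>
  B3 r2)\<close>, and the product of the four factors is \<open>G\<close> up to a constant (\<open>poly_G\<close>,
  \<open>quartic_form_factored\<close>). This factorisation also shows that square roots suffice to express all
  roots (\<open>system_polynomial_solvable\<close>).

  For the determinant \<open>D\<close> itself, four properties are read off the explicit matrix (\<open>Dix_entries\<close>):
  it vanishes at every solution, because the vector of monomials of a solution lies in the kernel
  (\<open>det_dixon_mat_eq_0\<close>); it is divisible by \<open>(4 q0^2 - 1)^4\<close>, by column operations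
  (\<open>quadratic_factor_dvd_det\<close>); its degree is at most 16, because of the degrees of its entries
  (\<open>degree_det_system_Dix\<close>); and its constant term is \<open>\<plusminus> 65536 w3^2\<close>, by elimination
  (\<open>det_dixon_mat_0\<close>). For generic parameters \<open>G\<close> has eight distinct nonzero roots that do not solve
  \<open>4 q0^2 = 1\<close>; then \<open>D / (4 q0^2 - 1)^4\<close> has degree at most 8, vanishes at these roots and has, up
  to sign, the constant term of \<open>G\<close>, so it equals \<open>G\<close> up to sign (\<open>generic_determinant\<close>). Finally,
  both sides are polynomial in the parameters, so the equality extends from generic to all
  parameters (\<open>determinant_formula\<close>).\<close>

section \<open>Polynomials in several indeterminates\<close>

lemma Const_simps:
  "Const 0 = 0" "Const 1 = 1" "Const (a + b) = Const a + Const b" "Const (a - b) = Const a - Const b"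
  "Const (- a) = - Const a" "Const (a * b) = Const a * Const b" "Const (numeral n) = numeral n"
  by (simp_all add: Const_def single_add single_diff single_uminus mult_single)

lemma Const_power: "Const (a ^ n) = Const a ^ n"
  by (induction n) (simp_all add: Const_simps)

text \<open>Writing polynomials as sums of monomials reduces the multiplicativity of \<open>subst\<close> and the
  computation of coefficients of products to the case of monomials.\<close>

lemma poly_mapping_eq_sum_single:
  "p = (\<Sum>m\<in>Poly_Mapping.keys p. Poly_Mapping.single m (Poly_Mapping.lookup p m))"
proof (rule poly_mapping_eqI)
  fix k
  show "Poly_Mapping.lookup p k =
    Poly_Mapping.lookup (\<Sum>m\<in>Poly_Mapping.keys p. Poly_Mapping.single m (Poly_Mapping.lookup p m)) k"
    by (simp add: lookup_sum lookup_single when_def in_keys_iff)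
qed

text \<open>The summation range in the definition of \<open>subst\<close> depends on the polynomial. Additivity becomes
  visible once two polynomials are summed over a common range.\<close>

lemma subst_superset:
  assumes "finite S" "Poly_Mapping.keys p \<subseteq> S"
  shows "subst \<sigma> p = (\<Sum>m\<in>S. Const (Poly_Mapping.lookup p m)
           * (\<Prod>i\<in>Poly_Mapping.keys m. \<sigma> i ^ Poly_Mapping.lookup m i))"
  unfolding subst_def using assms
  by (intro sum.mono_neutral_left) (auto simp: in_keys_iff Const_simps)

lemma subst_single:
  "subst \<sigma> (Poly_Mapping.single m c) =
     Const c * (\<Prod>i\<in>Poly_Mapping.keys m. \<sigma> i ^ Poly_Mapping.lookup m i)"
  by (simp add: subst_superset[of "{m}"])

lemma subst_add: "subst \<sigma> (p + q) = subst \<sigma> p + subst \<sigma> q"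
proof -
  let ?S = "Poly_Mapping.keys p \<union> Poly_Mapping.keys q"
  have "Poly_Mapping.keys (p + q) \<subseteq> ?S" by (rule Poly_Mapping.keys_add)
  then show ?thesis
    by (simp add: subst_superset[of ?S] lookup_add Const_simps distrib_right sum.distrib)
qed

lemma subst_0: "subst \<sigma> 0 = 0"
  by (simp add: subst_def)

lemma subst_sum: "subst \<sigma> (sum f A) = (\<Sum>x\<in>A. subst \<sigma> (f x))"
  by (induction A rule: infinite_finite_induct) (simp_all add: subst_add subst_0)

lemma subst_diff: "subst \<sigma> (p - q) = subst \<sigma> p - subst \<sigma> q"
  by (metis add_diff_cancel diff_add_cancel subst_add)

lemma prod_keys_superset:
  assumes "finite S" "Poly_Mapping.keys m \<subseteq> S"
  shows "(\<Prod>i\<in>Poly_Mapping.keys m. \<sigma> i ^ Poly_Mapping.lookup m i) =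
         (\<Prod>i\<in>S. (\<sigma> i ^ Poly_Mapping.lookup m i :: 'a :: comm_monoid_mult))"
  using assms by (intro prod.mono_neutral_left) (auto simp: in_keys_iff)

lemma prod_keys_add:
  fixes \<sigma> :: "nat \<Rightarrow> 'a :: comm_monoid_mult"
  shows "(\<Prod>i\<in>Poly_Mapping.keys (m + n). \<sigma> i ^ Poly_Mapping.lookup (m + n) i) =
    (\<Prod>i\<in>Poly_Mapping.keys m. \<sigma> i ^ Poly_Mapping.lookup m i) *
    (\<Prod>i\<in>Poly_Mapping.keys n. \<sigma> i ^ Poly_Mapping.lookup n i)"
proof -
  let ?S = "Poly_Mapping.keys m \<union> Poly_Mapping.keys n"
  have "Poly_Mapping.keys (m + n) \<subseteq> ?S" by (rule Poly_Mapping.keys_add)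
  then have "(\<Prod>i\<in>Poly_Mapping.keys (m + n). \<sigma> i ^ Poly_Mapping.lookup (m + n) i) =
      (\<Prod>i\<in>?S. \<sigma> i ^ Poly_Mapping.lookup m i) * (\<Prod>i\<in>?S. \<sigma> i ^ Poly_Mapping.lookup n i)"
    by (subst prod_keys_superset[of ?S]) (simp_all add: lookup_add power_add prod.distrib)
  also have "(\<Prod>i\<in>?S. \<sigma> i ^ Poly_Mapping.lookup m i) =
      (\<Prod>i\<in>Poly_Mapping.keys m. \<sigma> i ^ Poly_Mapping.lookup m i)"
    by (rule prod_keys_superset[symmetric]) simp_all
  also have "(\<Prod>i\<in>?S. \<sigma> i ^ Poly_Mapping.lookup n i) =
      (\<Prod>i\<in>Poly_Mapping.keys n. \<sigma> i ^ Poly_Mapping.lookup n i)"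
    by (rule prod_keys_superset[symmetric]) simp_all
  finally show ?thesis .
qed

lemma subst_mult: "subst \<sigma> (p * q) = subst \<sigma> p * subst \<sigma> q"
proof -
  have *: "subst \<sigma> (Poly_Mapping.single m c * Poly_Mapping.single n d) =
     subst \<sigma> (Poly_Mapping.single m c) * subst \<sigma> (Poly_Mapping.single n d)" for m n c d
    by (simp add: mult_single subst_single prod_keys_add Const_simps)
  show ?thesis
    by (subst poly_mapping_eq_sum_single[of p], subst poly_mapping_eq_sum_single[of q],
        subst (3) poly_mapping_eq_sum_single[of p], subst (3) poly_mapping_eq_sum_single[of q])
       (simp only: sum_product subst_sum *)
qed

lemma subst_Const: "subst \<sigma> (Const c) = Const c"
  by (simp add: Const_def subst_single)

lemma subst_Var: "subst \<sigma> (Var i) = \<sigma> i"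
  by (simp add: Var_def subst_single Const_simps)

lemma subst_power: "subst \<sigma> (p ^ n) = subst \<sigma> p ^ n"
  using subst_Const[of \<sigma> 1] by (induction n) (simp_all add: subst_mult Const_simps)

lemma subst_numeral: "subst \<sigma> (numeral n) = numeral n"
  using subst_Const[of \<sigma> "numeral n"] by (simp add: Const_simps)

lemma subst_1: "subst \<sigma> 1 = 1"
  using subst_Const[of \<sigma> 1] by (simp add: Const_simps)

lemmas subst_simps = subst_add subst_diff subst_mult subst_power subst_numeral subst_1
  subst_Const subst_Var

lemma Var_eq_iff: "Var i = (Var j :: 'a::comm_ring_1 mpol) \<longleftrightarrow> i = j"
proof
  assume "Var i = (Var j :: 'a mpol)"
  then have "Poly_Mapping.keys (Var i :: 'a mpol) = Poly_Mapping.keys (Var j :: 'a mpol)" by simp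
  then have "Poly_Mapping.single i (1::nat) = Poly_Mapping.single j 1" by (simp add: Var_def)
  then have "Poly_Mapping.keys (Poly_Mapping.single i (1::nat))
      = Poly_Mapping.keys (Poly_Mapping.single j (1::nat))"
    by simp
  then show "i = j" by simp
qed simp

lemma exact_quot_eqI:
  assumes "h * d = p" "d \<noteq> 0"
  shows "exact_quot p d = h"
  unfolding exact_quot_def using assms by (intro the_equality) auto

definition xmono :: "nat \<times> nat \<times> nat \<Rightarrow> 'a::comm_ring_1 mpol" where
  "xmono = (\<lambda>(a, b, c). Var 1 ^ a * Var 2 ^ b * Var 3 ^ c)"

lemma Var_power: "Var i ^ n = (Poly_Mapping.single (Poly_Mapping.single i n) 1 :: 'a::comm_ring_1 mpol)"
  by (induction n) (simp_all add: Var_def mult_single single_add[symmetric] add.commute)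

lemma xmono_eq_single: "xmono e = (Poly_Mapping.single (x_expo e) 1 :: 'a::comm_ring_1 mpol)"
  by (cases e) (simp add: xmono_def x_expo_def Var_power mult_single)

text \<open>Multiplication by a monomial shifts the coefficients.\<close>

lemma lookup_mult_single:
  fixes p :: "'a::comm_ring_1 mpol"
  shows "Poly_Mapping.lookup (Poly_Mapping.single m c * p) (m + n) = c * Poly_Mapping.lookup p n"
  and "(\<And>n. k \<noteq> m + n) \<Longrightarrow> Poly_Mapping.lookup (Poly_Mapping.single m c * p) k = 0"
proof -
  have *: "Poly_Mapping.lookup (Poly_Mapping.single m c * p) k =
    (\<Sum>l\<in>Poly_Mapping.keys p. c * Poly_Mapping.lookup p l when k = m + l)" for k
  proof -
    have "Poly_Mapping.lookup (Poly_Mapping.single m c * p) k =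
      Poly_Mapping.lookup (\<Sum>l\<in>Poly_Mapping.keys p. Poly_Mapping.single (m + l) (c * Poly_Mapping.lookup p l)) k"
      by (subst (1) poly_mapping_eq_sum_single[of p]) (simp add: sum_distrib_left mult_single)
    then show ?thesis by (simp add: lookup_sum lookup_single eq_commute)
  qed
  show "Poly_Mapping.lookup (Poly_Mapping.single m c * p) (m + n) = c * Poly_Mapping.lookup p n"
    unfolding * by (simp add: when_def in_keys_iff)
  show "(\<And>n. k \<noteq> m + n) \<Longrightarrow> Poly_Mapping.lookup (Poly_Mapping.single m c * p) k = 0"
    unfolding * by (simp add: when_def)
qed

lemma x_expo_plus_y_expo_inj:
  "x_expo e + y_expo f = x_expo e' + y_expo f' \<longleftrightarrow> e = e' \<and> f = f'"
proof
  assume eq: "x_expo e + y_expo f = x_expo e' + y_expo f'"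
  obtain a b c i j k a' b' c' i' j' k' where
    [simp]: "e = (a,b,c)" "f = (i,j,k)" "e' = (a',b',c')" "f' = (i',j',k')"
    by (metis prod_cases3)
  have "Poly_Mapping.lookup (x_expo e + y_expo f) n = Poly_Mapping.lookup (x_expo e' + y_expo f') n" for n
    using eq by simp
  from this[of 1] this[of 2] this[of 3] this[of 4] this[of 5] this[of 6]
  show "e = e' \<and> f = f'"
    by (simp add: x_expo_def y_expo_def lookup_add lookup_single)
qed simp

section \<open>The entries of the Dixon matrix\<close>

text \<open>All entries are integer polynomials in the parameters and \<open>q0\<close>. Over an arbitrary commutative
  ring the same list serves in \<open>\<complex>[q0]\<close> for the Dixon matrix itself, in \<open>\<complex>\<close> for its values, and in
  \<open>\<complex>[t]\<close> for parameters moving along a line.\<close>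

definition dixon_rows :: "'a::comm_ring_1 \<Rightarrow> 'a \<Rightarrow> 'a \<Rightarrow> 'a \<Rightarrow> 'a \<Rightarrow> 'a \<Rightarrow> 'a \<Rightarrow> 'a list list" where
  "dixon_rows a1 a2 a3 b1 b2 b3 q =
   [[0, 0, 0, 0, 0, 0, 0, 0, 0, 0, -a1, 0, 0, -a1, 2*b1, a1, -2*b1*q, 0, 0, a1*q^2],
    [0, 0, 0, 0, 0, 0, 0, 0, 0, 0, -a2, 2*b2, 0, a2, 0, -a2, 0, 0, -2*b2*q, a2*q^2],
    [0, 0, 0, 0, 0, 0, 0, 0, 0, 0, a3, 0, 2*b3, -a3, 0, -a3, 0, -2*b3*q, 0, a3*q^2],
    [0, 0, 0, 0, 0, 0, 0, 0, 0, 0, 1, 0, 0, 1, 0, 1, 0, 0, 0, q^2 - 1],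
    [-a1, 0, 0, -a1, 2*b1, a1, 0, 0, 0, 0, -2*b1*q, 0, 0, 0, 0, 0, a1*q^2, 0, 0, 0],
    [-a2, 2*b2, 0, a2, 0, -a2, 0, 0, 0, 0, 0, 0, -2*b2*q, 0, 0, 0, a2*q^2, 0, 0, 0],
    [a3, 0, 2*b3, -a3, 0, -a3, 0, 0, 0, 0, 0, -2*b3*q, 0, 0, 0, 0, a3*q^2, 0, 0, 0],
    [1, 0, 0, 1, 0, 1, 0, 0, 0, 0, 0, 0, 0, 0, 0, 0, q^2 - 1, 0, 0, 0],
    [0, -a1, 0, 0, 0, 0, -a1, 2*b1, a1, 0, 0, -2*b1*q, 0, 0, 0, 0, 0, a1*q^2, 0, 0],
    [0, -a2, 0, 2*b2, 0, 0, a2, 0, -a2, 0, 0, 0, 0, 0, -2*b2*q, 0, 0, a2*q^2, 0, 0],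
    [0, a3, 0, 0, 2*b3, 0, -a3, 0, -a3, 0, 0, 0, 0, -2*b3*q, 0, 0, 0, a3*q^2, 0, 0],
    [0, 1, 0, 0, 0, 0, 1, 0, 1, 0, 0, 0, 0, 0, 0, 0, 0, q^2 - 1, 0, 0],
    [0, 0, -a1, 0, 0, 0, 0, -a1, 2*b1, a1, 0, 0, -2*b1*q, 0, 0, 0, 0, 0, a1*q^2, 0],
    [0, 0, -a2, 0, 2*b2, 0, 0, a2, 0, -a2, 0, 0, 0, 0, 0, -2*b2*q, 0, 0, a2*q^2, 0],
    [0, 0, a3, 0, 0, 2*b3, 0, -a3, 0, -a3, 0, 0, 0, 0, -2*b3*q, 0, 0, 0, a3*q^2, 0],
    [0, 0, 1, 0, 0, 0, 0, 1, 0, 1, 0, 0, 0, 0, 0, 0, 0, 0, q^2 - 1, 0],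
    [0, 0, 0, 0, 16*a1*a2*a3*q^2 - 4*a1*a2*a3, -8*a2*a3*b1*q^2 + 4*a2*a3*b1, 0,
     -8*a1*a3*b2*q^2 + 4*a1*a3*b2, 8*a1*a2*b3*q^2 + 8*a3*b1*b2*q^2 - 4*a3*b1*b2,
     -8*a2*b1*b3*q^2 + 4*a2*b1*b3, 0, 8*a1*a3*b2*q^3 - 4*a1*a3*b2*q,
     8*a1*a2*b3*q^3 - 4*a1*a2*b3*q + 4*a3*b1*b2*q, 0,
     8*a1*b2*b3*q^3 + 8*a2*a3*b1*q^3 - 4*a2*a3*b1*q, -8*b1*b2*b3*q^3 + 8*b1*b2*b3*q,
     8*a1*b2*b3*q^4 - 4*a1*b2*b3*q^2, 8*a3*b1*b2*q^4 - 4*a3*b1*b2*q^2,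
     8*a2*b1*b3*q^4 - 4*a2*b1*b3*q^2, 8*b1*b2*b3*q^5 - 8*b1*b2*b3*q^3],
    [0, 0, 0, 0, -8*a2*a3*b1*q, 0, 0, 0, -8*a2*b1*b3*q, 0, 0,
     -8*a1*a2*b3*q^2 - 8*a3*b1*b2*q^2 + 4*a1*a2*b3, 8*a1*a3*b2*q^2 + 8*a2*b1*b3*q^2 - 4*a2*b1*b3,
     8*a1*b2*b3*q^2 - 4*a1*b2*b3, 16*a1*a2*a3*q^2 - 24*b1*b2*b3*q^2 - 4*a1*a2*a3 + 8*b1*b2*b3,
     -8*a2*a3*b1*q^2 + 4*a1*b2*b3 + 4*a2*a3*b1, -8*b1*b2*b3*q^3,
     8*a1*a3*b2*q^3 - 4*a1*a3*b2*q + 4*a2*b1*b3*q, 8*a1*a2*b3*q^3 + 8*a3*b1*b2*q^3 - 4*a1*a2*b3*q,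
     8*a1*b2*b3*q^4 - 4*a1*b2*b3*q^2],
    [0, 0, 0, 0, -8*a1*a2*b3*q, 0, 0, 8*a1*b2*b3*q, -8*b1*b2*b3*q, 0, 0, 8*a2*a3*b1*q^2,
     16*a1*a2*a3*q^2 - 8*b1*b2*b3*q^2 - 4*a1*a2*a3, -8*a3*b1*b2*q^2 + 4*a3*b1*b2,
     -8*a1*a3*b2*q^2 - 8*a2*b1*b3*q^2 + 4*a1*a3*b2 + 4*a2*b1*b3, 8*a1*a2*b3*q^2,
     8*a1*a3*b2*q^3 + 8*a2*b1*b3*q^3 - 4*a1*a3*b2*q - 4*a2*b1*b3*q,
     -16*b1*b2*b3*q^3 + 8*b1*b2*b3*q,
     8*a1*b2*b3*q^3 + 8*a2*a3*b1*q^3 - 4*a1*b2*b3*q - 4*a2*a3*b1*q,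
     8*a3*b1*b2*q^4 - 4*a3*b1*b2*q^2],
    [0, 0, 0, 0, -8*a1*a3*b2*q, 8*a3*b1*b2*q, 0, 0, -8*a1*b2*b3*q, 8*b1*b2*b3*q, 0,
     16*a1*a2*a3*q^2 - 4*a1*a2*a3, -8*a1*b2*b3*q^2 - 8*a2*a3*b1*q^2 + 4*a2*a3*b1,
     -8*a1*a3*b2*q^2 + 4*a1*a3*b2, 8*a1*a2*b3*q^2 + 8*a3*b1*b2*q^2 - 4*a3*b1*b2,
     -8*a2*b1*b3*q^2 + 4*a2*b1*b3, 8*a1*a2*b3*q^3 - 4*a1*a2*b3*q,
     8*a2*a3*b1*q^3 + 4*a1*b2*b3*q - 4*a2*a3*b1*q, -8*b1*b2*b3*q^3,
     8*a2*b1*b3*q^4 - 4*a2*b1*b3*q^2]]"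

definition cubic :: "'a::comm_ring_1 list \<Rightarrow> 'a \<Rightarrow> 'a \<Rightarrow> 'a \<Rightarrow> 'a" where
  "cubic r x1 x2 x3 = (\<Sum>(c, (i, j, k))\<leftarrow>zip r cubic_monomials. c * (x1 ^ i * x2 ^ j * x3 ^ k))"

text \<open>The determinant with columns \<open>a, b, c, d\<close>, expanded by the Laplace rule along the first two
  columns. A closed expression in columns makes multilinearity and the column operations on the
  matrix \<open>U\<close> easy to state.\<close>

definition vol :: "(nat \<Rightarrow> 'a::comm_ring_1) \<Rightarrow> (nat \<Rightarrow> 'a) \<Rightarrow> (nat \<Rightarrow> 'a) \<Rightarrow> (nat \<Rightarrow> 'a) \<Rightarrow> 'a" where
  "vol a b c d =
     (a 0 * b 1 - a 1 * b 0) * (c 2 * d 3 - c 3 * d 2) - (a 0 * b 2 - a 2 * b 0) * (c 1 * d 3 - c 3 * d 1)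
   + (a 0 * b 3 - a 3 * b 0) * (c 1 * d 2 - c 2 * d 1) + (a 1 * b 2 - a 2 * b 1) * (c 0 * d 3 - c 3 * d 0)
   - (a 1 * b 3 - a 3 * b 1) * (c 0 * d 2 - c 2 * d 0) + (a 2 * b 3 - a 3 * b 2) * (c 0 * d 1 - c 1 * d 0)"

lemma det_4x4:
  assumes "A \<in> carrier_mat 4 4"
  shows "det A = vol (\<lambda>i. A $$ (i,0)) (\<lambda>i. A $$ (i,1)) (\<lambda>i. A $$ (i,2)) (\<lambda>i. A $$ (i,3))"
proof -
  have d2: "det B = B $$ (0,0) * B $$ (1,1) - B $$ (0,1) * B $$ (1,0)" if B: "B \<in> carrier_mat 2 2"
      for B :: "'a mat"
  proof -
    have "det B = (\<Sum>i<2. B $$ (i,0) * cofactor B i 0)"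
      by (rule laplace_expansion_column[OF B]) simp
    then show ?thesis
      using B by (simp add: numeral_eq_Suc lessThan_Suc cofactor_def det_single mat_delete_def algebra_simps)
  qed
  have d3: "det B = B $$ (0,0) * (B $$ (1,1) * B $$ (2,2) - B $$ (2,1) * B $$ (1,2))
      - B $$ (1,0) * (B $$ (0,1) * B $$ (2,2) - B $$ (2,1) * B $$ (0,2))
      + B $$ (2,0) * (B $$ (0,1) * B $$ (1,2) - B $$ (1,1) * B $$ (0,2))"
          if B: "B \<in> carrier_mat 3 3" for B :: "'a mat"
  proof -
    have "det B = (\<Sum>i<3. B $$ (i,0) * cofactor B i 0)"
      by (rule laplace_expansion_column[OF B]) simp
    then show ?thesis
      using B by (simp add: numeral_eq_Suc lessThan_Suc cofactor_def d2[unfolded numeral_2_eq_2]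
          mat_delete_def algebra_simps)
  qed
  have "det A = (\<Sum>i<4. A $$ (i,0) * cofactor A i 0)"
    by (rule laplace_expansion_column[OF assms]) simp
  then show ?thesis
    using assms by (simp add: numeral_eq_Suc lessThan_Suc cofactor_def d3[unfolded numeral_3_eq_3]
        mat_delete_def vol_def algebra_simps)
qed

lemma vol_linear:
  fixes y :: "'a::comm_ring_1"
  shows "vol (\<lambda>i. a i + y * a' i) b c d = vol a b c d + y * vol a' b c d"
    and "vol a (\<lambda>i. b i + y * b' i) c d = vol a b c d + y * vol a b' c d"
    and "vol a b (\<lambda>i. c i + y * c' i) d = vol a b c d + y * vol a b c' d"
    and "vol a b c (\<lambda>i. d i + y * d' i) = vol a b c d + y * vol a b c d'"
  by (simp_all add: vol_def algebra_simps)

lemma vol_repeat: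
  fixes a :: "nat \<Rightarrow> 'a::comm_ring_1"
  shows "vol a b c a = 0" "vol a b c b = 0" "vol a b c c = 0"
  by (simp_all add: vol_def algebra_simps)

lemma vol_cong:
  assumes "\<And>i. i < 4 \<Longrightarrow> a i = a' i" "\<And>i. i < 4 \<Longrightarrow> b i = b' i"
    "\<And>i. i < 4 \<Longrightarrow> c i = c' i"
  shows "vol a b c d = vol a' b' c' d"
  using assms by (simp add: vol_def)

text \<open>The last column of \<open>U\<close> is \<open>f(y)\<close>, which differs from \<open>f(x)\<close> by the combination of the other
  three columns with coefficients \<open>x_i - y_i\<close>. So \<open>f(y)\<close> may be replaced by \<open>f(x)\<close>, which removes
  most of the \<open>y\<close> and shows that all coefficients of \<open>det U\<close> lie in the ideal generated by the
  \<open>f_i(x)\<close>.\<close>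

lemma vol_last_column:
  fixes r1 :: "'a::comm_ring_1"
  assumes "\<And>i. i < 4 \<Longrightarrow> d i = d' i + r1 * a i + r2 * b i + r3 * c i"
  shows "vol a b c d = vol a b c d'"
proof -
  have "vol a b c d = vol a b c (\<lambda>i. d' i + r1 * a i + r2 * b i + r3 * c i)"
    using assms[of 0] assms[of 1] assms[of 2] assms[of 3] by (simp add: vol_def)
  also have "\<dots> = vol a b c d'"
    by (simp add: vol_linear vol_repeat)
  finally show ?thesis .
qed

text \<open>The expansion of \<open>det U\<close> up to first order in \<open>y1, y2, y3\<close>: the columns are affine in \<open>y\<close>, and
  the second and third depend on \<open>y1\<close> and on \<open>y1, y2\<close> as well, because the substitutions of \<open>y\<close> for
  \<open>x\<close> are made one after the other.\<close>

lemma vol_first_order: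
  fixes y1 :: "'a::comm_ring_1"
  shows "\<exists>R11 R12 R13 R22 R23.
     vol (\<lambda>i. u1 i + y1 * v1 i) (\<lambda>i. u2 i + y1 * h2 i + y2 * v2 i)
         (\<lambda>i. u3 i + y1 * h3 i + y2 * z3 i + y3 * v3 i) f =
     vol u1 u2 u3 f
     + y1 * (vol v1 u2 u3 f + vol u1 h2 u3 f + vol u1 u2 h3 f)
     + y2 * (vol u1 v2 u3 f + vol u1 u2 z3 f)
     + y3 * vol u1 u2 v3 f
     + y1 * y1 * R11 + y1 * y2 * R12 + y1 * y3 * R13 + y2 * y2 * R22 + y2 * y3 * R23"
  by (rule exI[of _ "vol v1 h2 u3 f + vol v1 u2 h3 f + vol u1 h2 h3 f + y1 * vol v1 h2 h3 f"],
      rule exI[of _ "vol v1 v2 u3 f + vol v1 u2 z3 f + vol u1 h2 z3 f + vol u1 v2 h3 f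
                     + y1 * vol v1 h2 z3 f + y1 * vol v1 v2 h3 f + y2 * vol v1 v2 z3 f"],
      rule exI[of _ "vol v1 u2 v3 f + vol u1 h2 v3 f + y1 * vol v1 h2 v3 f + y2 * vol v1 v2 v3 f"],
      rule exI[of _ "vol u1 v2 z3 f"],
      rule exI[of _ "vol u1 v2 v3 f"])
     (simp only: vol_linear, simp only: algebra_simps)

definition col4 :: "'a \<Rightarrow> 'a \<Rightarrow> 'a \<Rightarrow> 'a \<Rightarrow> nat \<Rightarrow> 'a" where
  "col4 a b c d i = [a, b, c, d] ! i"

text \<open>The last four rows of the Dixon matrix as determinants with last column \<open>f(x)\<close>. This form
  serves to compute the rows, and it shows that the four cubics vanish wherever \<open>f1, ..., f4\<close> do.\<close>

lemma psi_determinants: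
  fixes a1 :: "'a::comm_ring_1"
  assumes R: "R = dixon_rows a1 a2 a3 b1 b2 b3 q"
    and u1: "u1 = col4 (- (a1*x1) - 2*b1*q) (2*b2*x2 - a2*x1) (a3*x1 + 2*b3*x3) x1"
    and u2: "u2 = col4 (2*b1*x3 - a1*x2) (a2*x2) (- (a3*x2) - 2*b3*q) x2"
    and u3: "u3 = col4 (a1*x3) (- (a2*x3) - 2*b2*q) (- (a3*x3)) x3"
    and f: "f = col4 (F1 a1 b1 q x1 x2 x3) (F2 a2 b2 q x1 x2 x3) (F3 a3 b3 q x1 x2 x3) (F4 q x1 x2 x3)"
  shows "cubic (R!16) x1 x2 x3 = vol u1 u2 u3 f"
    and "cubic (R!17) x1 x2 x3 = vol (col4 (- a1) (- a2) a3 1) u2 u3 f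
           + vol u1 (col4 0 (2*b2) 0 0) u3 f + vol u1 u2 (col4 0 0 (2*b3) 0) f"
    and "cubic (R!18) x1 x2 x3 = vol u1 (col4 (- a1) a2 (- a3) 1) u3 f + vol u1 u2 (col4 (2*b1) 0 0 0) f"
    and "cubic (R!19) x1 x2 x3 = vol u1 u2 (col4 a1 (- a2) (- a3) 1) f"
  unfolding assms vol_def cubic_def
  by (simp_all add: dixon_rows_def cubic_monomials_def col4_def F1_def F2_def F3_def F4_def
      algebra_simps power_numeral_reduce)

lemma psi_expansion:
  fixes a1 :: "'a::comm_ring_1"
  assumes R_def: "R = dixon_rows a1 a2 a3 b1 b2 b3 q"
  shows "\<exists>R11 R12 R13 R22 R23. vol
     (col4 (- (a1*(x1 + y1)) - 2*b1*q) (2*b2*x2 - a2*(x1 + y1)) (a3*(x1 + y1) + 2*b3*x3) (x1 + y1))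
     (col4 (2*b1*x3 - a1*(x2 + y2)) (a2*(x2 + y2) + 2*b2*y1) (- (a3*(x2 + y2)) - 2*b3*q) (x2 + y2))
     (col4 (a1*(x3 + y3) + 2*b1*y2) (- (a2*(x3 + y3)) - 2*b2*q) (2*b3*y1 - a3*(x3 + y3)) (x3 + y3))
     (col4 (F1 a1 b1 q y1 y2 y3) (F2 a2 b2 q y1 y2 y3) (F3 a3 b3 q y1 y2 y3) (F4 q y1 y2 y3)) =
     cubic (R!16) x1 x2 x3 + y1 * cubic (R!17) x1 x2 x3 + y2 * cubic (R!18) x1 x2 x3 + y3 * cubic (R!19) x1 x2 x3
     + y1 * y1 * R11 + y1 * y2 * R12 + y1 * y3 * R13 + y2 * y2 * R22 + y2 * y3 * R23"
   (is "\<exists>R11 R12 R13 R22 R23. vol ?c1 ?c2 ?c3 ?f = _")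
proof -
  let ?u1 = "col4 (- (a1*x1) - 2*b1*q) (2*b2*x2 - a2*x1) (a3*x1 + 2*b3*x3) x1"
  let ?v1 = "col4 (- a1) (- a2) a3 1"
  let ?u2 = "col4 (2*b1*x3 - a1*x2) (a2*x2) (- (a3*x2) - 2*b3*q) x2"
  let ?h2 = "col4 0 (2*b2) 0 0"
  let ?v2 = "col4 (- a1) a2 (- a3) 1"
  let ?u3 = "col4 (a1*x3) (- (a2*x3) - 2*b2*q) (- (a3*x3)) x3"
  let ?h3 = "col4 0 0 (2*b3) 0"
  let ?z3 = "col4 (2*b1) 0 0 0"
  let ?v3 = "col4 a1 (- a2) (- a3) 1"
  let ?g = "col4 (F1 a1 b1 q x1 x2 x3) (F2 a2 b2 q x1 x2 x3) (F3 a3 b3 q x1 x2 x3) (F4 q x1 x2 x3)"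
  have lt4: "i < 4 \<longleftrightarrow> i \<in> {0, 1, 2, 3}" for i :: nat by auto
  have "vol ?c1 ?c2 ?c3 ?f = vol ?c1 ?c2 ?c3 ?g"
  proof (rule vol_last_column[where ?r1.0 = "x1 - y1" and ?r2.0 = "x2 - y2" and ?r3.0 = "x3 - y3", symmetric])
    fix i :: nat assume "i < 4"
    then show "?g i = ?f i + (x1 - y1) * ?c1 i + (x2 - y2) * ?c2 i + (x3 - y3) * ?c3 i"
      unfolding lt4 by (elim insertE emptyE; simp add: col4_def F1_def F2_def F3_def F4_def
          algebra_simps power2_eq_square)
  qed
  also have "\<dots> = vol (\<lambda>i. ?u1 i + y1 * ?v1 i) (\<lambda>i. ?u2 i + y1 * ?h2 i + y2 * ?v2 i)
         (\<lambda>i. ?u3 i + y1 * ?h3 i + y2 * ?z3 i + y3 * ?v3 i) ?g"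
    by (intro vol_cong; (unfold lt4, elim insertE emptyE; simp add: col4_def algebra_simps))
  finally have eq: "vol ?c1 ?c2 ?c3 ?f = vol (\<lambda>i. ?u1 i + y1 * ?v1 i) (\<lambda>i. ?u2 i + y1 * ?h2 i + y2 * ?v2 i)
         (\<lambda>i. ?u3 i + y1 * ?h3 i + y2 * ?z3 i + y3 * ?v3 i) ?g" .
  note psi = psi_determinants[OF R_def HOL.refl HOL.refl HOL.refl HOL.refl, of x1 x2 x3]
  show ?thesis using vol_first_order[of ?u1 y1 ?v1 ?u2 ?h2 y2 ?v2 ?u3 ?h3 ?z3 y3 ?v3 ?g]
    unfolding psi eq .
qed

lemma lookup_Var_mult:
  "Poly_Mapping.lookup (Var i * p) k =
     (if Poly_Mapping.lookup k i = 0 then 0 else Poly_Mapping.lookup p (k - Poly_Mapping.single i 1))"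
proof (cases "Poly_Mapping.lookup k i = 0")
  case True
  then have "k \<noteq> Poly_Mapping.single i 1 + n" for n
    by (auto simp: lookup_add)
  then show ?thesis using True lookup_mult_single(2)[of k "Poly_Mapping.single i 1" 1 p] by (simp add: Var_def)
next
  case False
  then have "k = Poly_Mapping.single i 1 + (k - Poly_Mapping.single i 1)"
    by (intro poly_mapping_eqI) (auto simp: lookup_add lookup_minus lookup_single when_def)
  then show ?thesis using False lookup_mult_single(1)[of "Poly_Mapping.single i 1" 1 p "k
      - Poly_Mapping.single i 1"]
    by (simp add: Var_def)
qed

lemma lookup_x_expo_y: "i \<in> {4, 5, 6} \<Longrightarrow> Poly_Mapping.lookup (x_expo m) i = 0"
  by (cases m) (auto simp: x_expo_def lookup_add lookup_single)

definition xcubic :: "'a::comm_ring_1 list \<Rightarrow> 'a mpol" where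
  "xcubic r = cubic (map Const r) (Var 1) (Var 2) (Var 3)"

lemma xcubic_eq:
  "xcubic r = (\<Sum>(c, e)\<leftarrow>zip r cubic_monomials. Poly_Mapping.single (x_expo e) c)"
proof -
  have "Const c * (Var 1 ^ i * Var 2 ^ j * Var 3 ^ k) = Poly_Mapping.single (x_expo (i, j, k)) c"
    for c :: 'a and i j k
  proof -
    have "Const c * xmono (i, j, k) = Poly_Mapping.single (x_expo (i, j, k)) c"
      by (simp add: xmono_eq_single Const_def mult_single)
    then show ?thesis by (simp add: xmono_def)
  qed
  then show ?thesis
    by (simp add: xcubic_def cubic_def zip_map1 o_def case_prod_unfold)
qed

lemma lookup_sum_list: "Poly_Mapping.lookup (\<Sum>x\<leftarrow>xs. f x) k = (\<Sum>x\<leftarrow>xs. Poly_Mapping.lookup (f x) k)"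
  by (induction xs) (simp_all add: lookup_add)

lemma zip_sum_select:
  assumes "distinct ms" "length r = length ms"
  shows "map (\<lambda>m. \<Sum>(c, e)\<leftarrow>zip r ms. c when e = m) ms = (r :: 'a::comm_monoid_add list)"
proof (rule nth_equalityI)
  fix i assume "i < length (map (\<lambda>m. \<Sum>(c, e)\<leftarrow>zip r ms. c when e = m) ms)"
  then have i: "i < length ms" by simp
  have "(\<Sum>(c, e)\<leftarrow>zip r ms. c when e = ms ! i) = (\<Sum>j<length ms. r ! j when ms ! j = ms ! i)"
    using assms(2) by (simp add: sum_list_sum_nth lessThan_atLeast0)
  also have "\<dots> = (\<Sum>j<length ms. if j = i then r ! j else 0)"
    using assms(1) i by (intro sum.cong) (auto simp: when_def nth_eq_iff_index_eq)
  also have "\<dots> = r ! i" using i by simp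
  finally show "map (\<lambda>m. \<Sum>(c, e)\<leftarrow>zip r ms. c when e = m) ms ! i = r ! i" using i by simp
qed (simp add: assms)

lemma coeff_row_xcubic:
  assumes "length r = 20"
  shows "coeff_row (xcubic r) = r"
proof -
  have inj: "x_expo e = x_expo e' \<longleftrightarrow> e = e'" for e e'
    using x_expo_plus_y_expo_inj[of e "(0,0,0)" e' "(0,0,0)"] by (auto simp: y_expo_def)
  have "coeff_row (xcubic r) = map (\<lambda>m. \<Sum>(c, e)\<leftarrow>zip r cubic_monomials. c when e = m) cubic_monomials"
    by (simp add: coeff_row_def xcubic_eq lookup_sum_list lookup_single case_prod_unfold inj)
  also have "\<dots> = r"
    by (rule zip_sum_select) (use assms in \<open>simp_all add: cubic_monomials_def\<close>)
  finally show ?thesis .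
qed

text \<open>The terms of order at least two in \<open>y\<close> do not contribute to \<open>\<psi>_000, \<psi>_100, \<psi>_010, \<psi>_001\<close>, so
  their coefficients \<open>R11, ...\<close> can stay arbitrary polynomials.\<close>

lemma psi_rows_first_order:
  fixes r0 :: "'a::comm_ring_1 list"
  assumes len: "length r0 = 20" "length r1 = 20" "length r2 = 20" "length r3 = 20"
    and D: "D = xcubic r0 + Var 4 * xcubic r1 + Var 5 * xcubic r2 + Var 6 * xcubic r3
     + Var 4 * Var 4 * R11 + Var 4 * Var 5 * R12 + Var 4 * Var 6 * R13 + Var 5 * Var 5 * R22 + Var 5 * Var 6 * R23"
  shows "map (psi_row D) [(0,0,0), (1,0,0), (0,1,0), (0,0,1)] = [r0, r1, r2, r3]"
proof -
  have row: "psi_row D ijk = coeff_row (xcubic r)"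
    if "\<And>m. Poly_Mapping.lookup D (x_expo m + y_expo ijk) = Poly_Mapping.lookup (xcubic r) (x_expo m)" for ijk r
    by (simp add: psi_row_def coeff_row_def that)
  have y_zero: "Poly_Mapping.lookup (xcubic r) (x_expo m + Poly_Mapping.single j (Suc 0)) = 0" if "j \<in> {4,5,6}"
    for r :: "'a list" and m j
  proof -
    have "x_expo e \<noteq> x_expo m + Poly_Mapping.single j (Suc 0)" for e
    proof
      assume "x_expo e = x_expo m + Poly_Mapping.single j (Suc 0)"
      from arg_cong[OF this, of "\<lambda>f. Poly_Mapping.lookup f j"] show False
        using that lookup_x_expo_y[of j] by (simp add: lookup_add)
    qed
    then show ?thesis by (simp add: xcubic_eq lookup_sum_list lookup_single case_prod_unfold)
  qed
  note simps = D lookup_add mult.assoc lookup_Var_mult lookup_x_expo_y y_expo_def y_zero lookup_single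
  have "psi_row D (0,0,0) = coeff_row (xcubic r0)" by (rule row) (simp add: simps)
  moreover have "psi_row D (1,0,0) = coeff_row (xcubic r1)" by (rule row) (simp add: simps)
  moreover have "psi_row D (0,1,0) = coeff_row (xcubic r2)" by (rule row) (simp add: simps)
  moreover have "psi_row D (0,0,1) = coeff_row (xcubic r3)" by (rule row) (simp add: simps)
  ultimately show ?thesis by (simp add: coeff_row_xcubic len)
qed

lemma dixon_rows_Const:
  "map (map Const) (dixon_rows a1 a2 a3 b1 b2 b3 q) =
     dixon_rows (Const a1) (Const a2) (Const a3) (Const b1) (Const b2) (Const b3) (Const q)"
  by (simp add: dixon_rows_def Const_simps Const_power)

lemma dixon_rows_lengths:
  "length (dixon_rows a1 a2 a3 b1 b2 b3 q) = 20"
  "\<forall>r\<in>set (dixon_rows a1 a2 a3 b1 b2 b3 q). length r = 20"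
  by (simp_all add: dixon_rows_def)

text \<open>The divided differences are identified by multiplying back: polynomials over an integral
  domain form an integral domain, so the exact quotient is unique.\<close>

lemma dixon_U_rows:
  fixes a b q :: "'a::idom"
  shows "dixon_U_row (F1 (Const a) (Const b) (Const q) (Var 1) (Var 2) (Var 3)) =
     [- (Const a*(Var 1 + Var 4)) - 2*Const b*Const q, 2*Const b*Var 3 - Const a*(Var 2 + Var 5),
      Const a*(Var 3 + Var 6) + 2*Const b*Var 5, F1 (Const a) (Const b) (Const q) (Var 4) (Var 5) (Var 6)]"
  and "dixon_U_row (F2 (Const a) (Const b) (Const q) (Var 1) (Var 2) (Var 3)) =
     [2*Const b*Var 2 - Const a*(Var 1 + Var 4), Const a*(Var 2 + Var 5) + 2*Const b*Var 4,
      - (Const a*(Var 3 + Var 6)) - 2*Const b*Const q, F2 (Const a) (Const b) (Const q) (Var 4) (Var 5) (Var 6)]"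
  and "dixon_U_row (F3 (Const a) (Const b) (Const q) (Var 1) (Var 2) (Var 3)) =
     [Const a*(Var 1 + Var 4) + 2*Const b*Var 3, - (Const a*(Var 2 + Var 5)) - 2*Const b*Const q,
      2*Const b*Var 4 - Const a*(Var 3 + Var 6), F3 (Const a) (Const b) (Const q) (Var 4) (Var 5) (Var 6)]"
  and "dixon_U_row (F4 (Const q) (Var 1) (Var 2) (Var 3)) =
     [Var 1 + Var 4, Var 2 + Var 5, Var 3 + Var 6, F4 (Const q) (Var 4) (Var 5) (Var 6)]"
  unfolding dixon_U_row_def Let_def F1_def F2_def F3_def F4_def subst_simps
  by (simp_all, (intro conjI exact_quot_eqI; simp add: Var_eq_iff algebra_simps power2_eq_square)+)

theorem Dix_entries:
  fixes a1 a2 a3 b1 b2 b3 q :: "'a::idom"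
  shows "Dix (F1 (Const a1) (Const b1) (Const q) (Var 1) (Var 2) (Var 3))
             (F2 (Const a2) (Const b2) (Const q) (Var 1) (Var 2) (Var 3))
             (F3 (Const a3) (Const b3) (Const q) (Var 1) (Var 2) (Var 3))
             (F4 (Const q) (Var 1) (Var 2) (Var 3)) =
         mat_of_rows_list 20 (dixon_rows a1 a2 a3 b1 b2 b3 q)"
proof -
  define R where "R = dixon_rows a1 a2 a3 b1 b2 b3 q"
  define f1 where "f1 = F1 (Const a1) (Const b1) (Const q) (Var 1) (Var 2) (Var 3)"
  define f2 where "f2 = F2 (Const a2) (Const b2) (Const q) (Var 1) (Var 2) (Var 3)"
  define f3 where "f3 = F3 (Const a3) (Const b3) (Const q) (Var 1) (Var 2) (Var 3)"
  define f4 where "f4 = F4 (Const q) (Var 1) (Var 2) (Var 3)"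
  define D where "D = det (dixon_U f1 f2 f3 f4)"
  have len: "length R = 20" "\<And>i. i < 20 \<Longrightarrow> length (R ! i) = 20"
    using dixon_rows_lengths[of a1 a2 a3 b1 b2 b3 q] by (simp_all add: R_def)
  have RC: "dixon_rows (Const a1) (Const a2) (Const a3) (Const b1) (Const b2) (Const b3) (Const q) ! i
      = map Const (R ! i)" if "i < 20" for i
    using that len by (simp add: R_def flip: dixon_rows_Const)
  have D_vol: "D = vol
     (col4 (- (Const a1*(Var 1 + Var 4)) - 2*Const b1*Const q) (2*Const b2*Var 2 - Const a2*(Var 1
         + Var 4)) (Const a3*(Var 1 + Var 4) + 2*Const b3*Var 3) (Var 1 + Var 4))
     (col4 (2*Const b1*Var 3 - Const a1*(Var 2 + Var 5)) (Const a2*(Var 2 + Var 5)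
         + 2*Const b2*Var 4) (- (Const a3*(Var 2 + Var 5)) - 2*Const b3*Const q) (Var 2 + Var 5))
     (col4 (Const a1*(Var 3 + Var 6) + 2*Const b1*Var 5) (- (Const a2*(Var 3
         + Var 6)) - 2*Const b2*Const q) (2*Const b3*Var 4 - Const a3*(Var 3 + Var 6)) (Var 3 + Var 6))
     (col4 (F1 (Const a1) (Const b1) (Const q) (Var 4) (Var 5) (Var 6)) (F2 (Const a2) (Const b2) (Const
         q) (Var 4) (Var 5) (Var 6))
       (F3 (Const a3) (Const b3) (Const q) (Var 4) (Var 5) (Var 6)) (F4 (Const q) (Var 4) (Var 5) (Var 6)))"
  proof -
    have carr: "dixon_U f1 f2 f3 f4 \<in> carrier_mat 4 4"
    proof -
      have len: "length (map dixon_U_row [f1, f2, f3, f4]) = 4" by (simp only: length_map list.size)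
      show ?thesis unfolding dixon_U_def mat_of_rows_list_def len by (rule mat_carrier)
    qed
    show ?thesis unfolding D_def det_4x4[OF carr]
      unfolding dixon_U_def f1_def f2_def f3_def f4_def list.map dixon_U_rows
      by (simp add: vol_def mat_of_rows_list_def col4_def)
  qed
  obtain R11 R12 R13 R22 R23 where "D = xcubic (R!16) + Var 4 * xcubic (R!17) + Var 5 * xcubic (R!18)
      + Var 6 * xcubic (R!19)
     + Var 4 * Var 4 * R11 + Var 4 * Var 5 * R12 + Var 4 * Var 6 * R13 + Var 5 * Var 5 * R22 + Var 5 * Var 6 * R23"
    using psi_expansion[OF HOL.refl, where ?a1.0 = "Const a1" and ?a2.0 = "Const a2" and ?a3.0 = "Const a3"
       and ?b1.0 = "Const b1" and ?b2.0 = "Const b2" and ?b3.0 = "Const b3" and q = "Const q"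
       and ?x1.0 = "Var 1" and ?x2.0 = "Var 2" and ?x3.0 = "Var 3"
       and ?y1.0 = "Var 4" and ?y2.0 = "Var 5" and ?y3.0 = "Var 6"]
    unfolding D_vol RC[of 16, simplified] RC[of 17, simplified] RC[of 18, simplified] RC[of 19,
        simplified] xcubic_def by blast
  from psi_rows_first_order[OF len(2) len(2) len(2) len(2) this]
  have psi: "map (psi_row D) [(0,0,0), (1,0,0), (0,1,0), (0,0,1)] = [R!16, R!17, R!18, R!19]" by simp
  have "[coeff_row (x * f). x \<leftarrow> [1, Var 1, Var 2, Var 3], f \<leftarrow> [f1, f2, f3, f4]] =
        map (\<lambda>i. coeff_row (xcubic (R ! i))) [0..<16]"
    unfolding xcubic_def R_def f1_def f2_def f3_def f4_def
    by (simp add: upt_rec dixon_rows_def cubic_def cubic_monomials_def Const_simps Const_power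
          F1_def F2_def F3_def F4_def algebra_simps power_numeral_reduce)
  also have "\<dots> = map (\<lambda>i. R ! i) [0..<16]"
    by (intro map_cong HOL.refl coeff_row_xcubic len) simp
  finally have rows: "[coeff_row (x * f). x \<leftarrow> [1, Var 1, Var 2, Var 3], f \<leftarrow> [f1, f2, f3, f4]]
      = map (\<lambda>i. R ! i) [0..<16]" .
  have upt: "[0..<20] = [0..<16] @ [16, 17, 18, 19]" by code_simp
  have "[coeff_row (x * f). x \<leftarrow> [1, Var 1, Var 2, Var 3], f \<leftarrow> [f1, f2, f3, f4]]
        @ map (psi_row D) [(0,0,0), (1,0,0), (0,1,0), (0,0,1)] = map (\<lambda>i. R ! i) [0..<20]"
    unfolding psi rows upt by (simp only: map_append list.map)
  also have "\<dots> = R" using len(1) by (metis map_nth)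
  finally show ?thesis unfolding Dix_def D_def f1_def f2_def f3_def f4_def R_def by simp
qed

section \<open>Divisibility and degree of a determinant\<close>

text \<open>Adding to each of the last \<open>m\<close> columns a combination of the first \<open>n\<close> columns does not change
  the determinant; if all these new columns are divisible by \<open>k\<close>, the factor \<open>k\<close> can be taken out
  \<open>m\<close> times.\<close>

lemma power_dvd_det_columns:
  fixes A :: "'a::idom mat"
  assumes A: "A \<in> carrier_mat (n + m) (n + m)"
    and dvd: "\<And>i j. i < n + m \<Longrightarrow> j < m \<Longrightarrow> k dvd A $$ (i, n + j) + (\<Sum>l<n. A $$ (i, l) * N l j)"
  shows "k ^ m dvd det A"
proof -
  define V where "V = mat (n + m) (n + m) (\<lambda>(l, j). if l = j then 1 else if l < n \<and> n \<le> j then N l (j - n) else 0)"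
  define c where "c i j = (SOME z. A $$ (i, n + j) + (\<Sum>l<n. A $$ (i, l) * N l j) = k * z)" for i j
  have c: "A $$ (i, n + j) + (\<Sum>l<n. A $$ (i, l) * N l j) = k * c i j" if "i < n + m" "j < m" for i j
    unfolding c_def by (rule someI_ex) (use dvd[OF that] in \<open>simp add: dvd_def\<close>)
  define B where "B = mat (n + m) (n + m) (\<lambda>(i, j). if j < n then A $$ (i, j) else c i (j - n))"
  define K where "K = mat (n + m) (n + m) (\<lambda>(i, j). if i = j then (if i < n then 1 else k) else 0)"
  have carr: "V \<in> carrier_mat (n + m) (n + m)" "B \<in> carrier_mat (n + m) (n + m)" "K \<in> carrier_mat (n + m) (n + m)"
    by (simp_all add: V_def B_def K_def)
  have "A * V = B * K"
  proof (rule eq_matI)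
    fix i j assume "i < dim_row (B * K)" "j < dim_col (B * K)"
    then have i: "i < n + m" and j: "j < n + m" by (simp_all add: B_def K_def)
    have "(A * V) $$ (i, j) = (\<Sum>l<n + m. A $$ (i, l) * V $$ (l, j))"
      using A carr(1) i j by (auto simp: scalar_prod_def lessThan_atLeast0 intro!: sum.cong)
    also have "\<dots> = (if j < n then A $$ (i, j) else c i (j - n) * k)"
    proof (cases "j < n")
      case True
      then have "(\<Sum>l<n + m. A $$ (i, l) * V $$ (l, j)) = (\<Sum>l<n + m. if l = j then A $$ (i, l) else 0)"
        using j by (intro sum.cong) (auto simp: V_def)
      then show ?thesis using True j by simp
    next
      case False
      have "(\<Sum>l<n + m. A $$ (i, l) * V $$ (l, j)) =
          (\<Sum>l<n + m. (if l = j then A $$ (i, l) else 0) + (if l < n then A $$ (i, l) * N l (j - n) else 0))"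
        using j False by (intro sum.cong) (auto simp: V_def)
      also have "\<dots> = A $$ (i, j) + (\<Sum>l<n + m. if l \<in> {..<n} then A $$ (i, l) * N l (j - n) else 0)"
        using j by (simp add: sum.distrib)
      also have "(\<Sum>l<n + m. if l \<in> {..<n} then A $$ (i, l) * N l (j - n) else 0)
          = (\<Sum>l<n. A $$ (i, l) * N l (j - n))"
        by (subst sum.inter_restrict[symmetric]) (auto intro!: sum.cong)
      finally show ?thesis using c[of i "j - n"] i j False by simp
    qed
    also have "\<dots> = (\<Sum>l<n + m. if l = j then B $$ (i, l) * (if j < n then 1 else k) else 0)"
      using i j by (simp add: B_def)
    also have "\<dots> = (\<Sum>l<n + m. B $$ (i, l) * K $$ (l, j))"
      using j by (intro sum.cong) (auto simp: K_def)
    also have "\<dots> = (B * K) $$ (i, j)"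
      using carr i j by (auto simp: scalar_prod_def lessThan_atLeast0 intro!: sum.cong)
    finally show "(A * V) $$ (i, j) = (B * K) $$ (i, j)" .
  qed (use A carr in auto)
  then have "det A * det V = det B * det K"
    using A carr by (metis det_mult)
  moreover have "det V = 1"
  proof -
    have "upper_triangular V" by (auto simp: V_def upper_triangular_def)
    then have "det V = prod_list (diag_mat V)" using carr(1) by (rule det_upper_triangular)
    also have "diag_mat V = map (\<lambda>_. 1) [0..<n + m]" by (auto simp: diag_mat_def V_def)
    finally show ?thesis by (simp add: map_replicate_const)
  qed
  moreover have "det K = k ^ m"
  proof -
    have "upper_triangular K" by (auto simp: K_def upper_triangular_def)
    then have "det K = prod_list (diag_mat K)" using carr(3) by (rule det_upper_triangular)
    also have "diag_mat K = map (\<lambda>_. 1) [0..<n] @ map (\<lambda>_. k) [n..<n + m]"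
      by (rule nth_equalityI) (auto simp: diag_mat_def K_def nth_append)
    finally show ?thesis by (simp add: map_replicate_const)
  qed
  ultimately show ?thesis by simp
qed

text \<open>A degree bound that also covers the bound \<open>degree p < 0\<close>, meaning \<open>p = 0\<close>; such bounds occur
  for the entries whose monomial has larger degree than the cubic of their row.\<close>

definition short :: "nat \<Rightarrow> 'a::zero poly \<Rightarrow> bool" where
  "short n p \<longleftrightarrow> (\<forall>i\<ge>n. coeff p i = 0)"

lemma short_simps [simp]:
  "short n 0" "short (Suc n) (pCons a p) \<longleftrightarrow> short n p"
  by (auto simp: short_def coeff_pCons split: nat.split)

lemma short_numeral [simp]: "short (numeral n) (pCons a p) \<longleftrightarrow> short (pred_numeral n) p"
  by (simp add: numeral_eq_Suc)

text \<open>If entry \<open>(i, j)\<close> has degree at most \<open>r i - c j\<close>, then every product in the Leibniz formula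
  has degree at most \<open>\<Sum>r - \<Sum>c\<close>.\<close>

lemma degree_det_le:
  fixes A :: "'a::idom poly mat"
  assumes A: "A \<in> carrier_mat n n"
    and short: "\<And>i j. i < n \<Longrightarrow> j < n \<Longrightarrow> short (Suc (r i) - c j) (A $$ (i, j))"
  shows "degree (det A) + (\<Sum>j<n. c j) \<le> (\<Sum>i<n. r i) \<or> det A = 0"
proof -
  have term_le: "(\<Prod>i = 0..<n. A $$ (i, p i)) = 0 \<or> degree (\<Prod>i = 0..<n. A $$ (i, p i)) + (\<Sum>j<n. c j) \<le> (\<Sum>i<n. r i)"
    if p: "p permutes {0..<n}" for p
  proof (rule disjCI)
    assume nz: "\<not> degree (\<Prod>i = 0..<n. A $$ (i, p i)) + (\<Sum>j<n. c j) \<le> (\<Sum>i<n. r i)"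
    show "(\<Prod>i = 0..<n. A $$ (i, p i)) = 0"
    proof (rule ccontr)
      assume "(\<Prod>i = 0..<n. A $$ (i, p i)) \<noteq> 0"
      then have nonzero: "A $$ (i, p i) \<noteq> 0" if "i < n" for i using that by simp
      have entry: "degree (A $$ (i, p i)) + c (p i) \<le> r i" if "i < n" for i
      proof -
        have "p i < n" using p that by (metis atLeastLessThan_iff permutes_in_image zero_le)
        then have *: "short (Suc (r i) - c (p i)) (A $$ (i, p i))" using short that by simp
        have "\<not> Suc (r i) - c (p i) \<le> degree (A $$ (i, p i))"
          using * nonzero[OF that] unfolding short_def by (metis leading_coeff_neq_0)
        then show ?thesis by simp
      qed
      have "degree (\<Prod>i = 0..<n. A $$ (i, p i)) + (\<Sum>j<n. c j) = (\<Sum>i<n. degree (A $$ (i, p i))) + (\<Sum>i<n. c (p i))"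
        using nonzero degree_prod_eq_sum_degree[of "{0..<n}" "\<lambda>i. A $$ (i, p i)"]
          sum.permute[OF p, of c] by (simp add: lessThan_atLeast0 o_def)
      also have "\<dots> = (\<Sum>i<n. degree (A $$ (i, p i)) + c (p i))" by (simp add: sum.distrib)
      also have "\<dots> \<le> (\<Sum>i<n. r i)" by (rule sum_mono) (simp add: entry)
      finally show False using nz by simp
    qed
  qed
  show ?thesis
  proof (cases "(\<Sum>j<n. c j) \<le> (\<Sum>i<n. r i)")
    case True
    have "degree (det A) \<le> (\<Sum>i<n. r i) - (\<Sum>j<n. c j)"
      unfolding det_def'[OF A]
    proof (rule degree_sum_le)
      fix p assume "p \<in> {p. p permutes {0..<n}}"
      then consider "(\<Prod>i = 0..<n. A $$ (i, p i)) = 0"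
        | "degree (\<Prod>i = 0..<n. A $$ (i, p i)) + (\<Sum>j<n. c j) \<le> (\<Sum>i<n. r i)"
        using term_le[of p] by blast
      then have "degree (\<Prod>i = 0..<n. A $$ (i, p i)) \<le> (\<Sum>i<n. r i) - (\<Sum>j<n. c j)"
      proof cases
        case 1
        show ?thesis unfolding 1 by simp
      qed simp
      then show "degree (signof p * (\<Prod>i = 0..<n. A $$ (i, p i))) \<le> (\<Sum>i<n. r i) - (\<Sum>j<n. c j)"
        by (simp add: sign_def)
    qed (simp add: finite_permutations)
    then show ?thesis using True by (intro disjI1) linarith
  next
    case False
    then have "det A = 0"
      unfolding det_def'[OF A] using term_le by (intro sum.neutral) fastforce
    then show ?thesis by simp
  qed
qed

section \<open>Zeros, quadratic factor and degree of the Dixon determinant\<close>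

definition dixon_mat :: "'a::comm_ring_1 \<Rightarrow> 'a \<Rightarrow> 'a \<Rightarrow> 'a \<Rightarrow> 'a \<Rightarrow> 'a \<Rightarrow> 'a \<Rightarrow> 'a mat" where
  "dixon_mat a1 a2 a3 b1 b2 b3 q = mat_of_rows_list 20 (dixon_rows a1 a2 a3 b1 b2 b3 q)"

lemma dixon_mat_carrier: "dixon_mat a1 a2 a3 b1 b2 b3 q \<in> carrier_mat 20 20"
  unfolding dixon_mat_def mat_of_rows_list_def dixon_rows_lengths by (rule mat_carrier)

lemma dixon_mat_index:
  "i < 20 \<Longrightarrow> j < 20 \<Longrightarrow> dixon_mat a1 a2 a3 b1 b2 b3 q $$ (i, j) = dixon_rows a1 a2 a3 b1 b2 b3 q ! i ! j"
  unfolding dixon_mat_def mat_of_rows_list_def dixon_rows_lengths by simp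

lemma system_Dix_eq:
  "system_Dix A1 A2 A3 B1 B2 B3 = dixon_mat [:A1:] [:A2:] [:A3:] [:B1:] [:B2:] [:B3:] [:0, 1:]"
  unfolding system_Dix_def Let_def Dix_entries dixon_mat_def ..

lemma det_dixon_mat_hom:
  assumes "comm_ring_hom h"
  shows "h (det (dixon_mat a1 a2 a3 b1 b2 b3 q)) =
         det (dixon_mat (h a1) (h a2) (h a3) (h b1) (h b2) (h b3) (h q))"
proof -
  interpret comm_ring_hom h by fact
  have h_numeral: "h (numeral n) = numeral n" for n
    using hom_of_nat[of "numeral n"] by simp
  have rows: "map (map h) (dixon_rows a1 a2 a3 b1 b2 b3 q) =
      dixon_rows (h a1) (h a2) (h a3) (h b1) (h b2) (h b3) (h q)"
    by (simp add: dixon_rows_def hom_distribs h_numeral)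
  have "map_mat h (dixon_mat a1 a2 a3 b1 b2 b3 q) =
      dixon_mat (h a1) (h a2) (h a3) (h b1) (h b2) (h b3) (h q)"
  proof (rule eq_matI)
    fix i j assume "i < dim_row (dixon_mat (h a1) (h a2) (h a3) (h b1) (h b2) (h b3) (h q))"
      "j < dim_col (dixon_mat (h a1) (h a2) (h a3) (h b1) (h b2) (h b3) (h q))"
    then have ij: "i < 20" "j < 20"
      using carrier_matD[OF dixon_mat_carrier[of "h a1" "h a2" "h a3" "h b1" "h b2" "h b3" "h q"]] by simp_all
    have "length (dixon_rows a1 a2 a3 b1 b2 b3 q ! i) = 20"
      using dixon_rows_lengths[of a1 a2 a3 b1 b2 b3 q] ij by simp
    then show "map_mat h (dixon_mat a1 a2 a3 b1 b2 b3 q) $$ (i, j) =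
        dixon_mat (h a1) (h a2) (h a3) (h b1) (h b2) (h b3) (h q) $$ (i, j)"
      using ij carrier_matD[OF dixon_mat_carrier[of a1 a2 a3 b1 b2 b3 q]] dixon_rows_lengths(1)[of a1 a2
          a3 b1 b2 b3 q]
      by (simp add: dixon_mat_index flip: rows)
  qed (simp_all add: carrier_matD[OF dixon_mat_carrier])
  then show ?thesis by (metis hom_det)
qed

lemma comm_ring_hom_poly: "comm_ring_hom (\<lambda>p. poly p (x::'a::comm_ring_1))"
  by unfold_locales simp_all

lemma poly_det_system_Dix:
  "poly (det (system_Dix A1 A2 A3 B1 B2 B3)) x = det (dixon_mat A1 A2 A3 B1 B2 B3 x)"
  unfolding system_Dix_eq det_dixon_mat_hom[OF comm_ring_hom_poly] by simp

text \<open>The right-hand side is a component of the Dixon matrix times the vector of monomials at a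
  point.\<close>

lemma cubic_eq_sum:
  assumes "length r = 20"
  shows "cubic r x1 x2 x3 = (\<Sum>j<20. r ! j * (case cubic_monomials ! j of (i, k, l) \<Rightarrow> x1 ^ i * x2 ^ k * x3 ^ l))"
proof -
  have "length cubic_monomials = 20" by (simp add: cubic_monomials_def)
  then show ?thesis
    using assms by (simp add: cubic_def sum_list_sum_nth lessThan_atLeast0 case_prod_unfold)
qed

lemma vol_zero: "vol a b c (col4 0 0 0 0) = 0"
  by (simp add: vol_def col4_def)

text \<open>At a common zero of \<open>f1, ..., f4\<close> all twenty cubics vanish, so the vector of monomials is a
  kernel vector; it is nonzero because the last monomial is 1.\<close>

lemma det_dixon_mat_eq_0:
  fixes a1 :: "'a::idom"
  assumes "F1 a1 b1 q x1 x2 x3 = 0" "F2 a2 b2 q x1 x2 x3 = 0" "F3 a3 b3 q x1 x2 x3 = 0" "F4 q x1 x2 x3 = 0"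
  shows "det (dixon_mat a1 a2 a3 b1 b2 b3 q) = 0"
proof -
  let ?M = "dixon_mat a1 a2 a3 b1 b2 b3 q" and ?R = "dixon_rows a1 a2 a3 b1 b2 b3 q"
  define v where "v = vec 20 (\<lambda>j. case cubic_monomials ! j of (i, k, l) \<Rightarrow> x1 ^ i * x2 ^ k * x3 ^ l)"
  have psi: "cubic (?R ! i) x1 x2 x3 = 0" if "i \<in> {16, 17, 18, 19}" for i
    using that psi_determinants[OF HOL.refl HOL.refl HOL.refl HOL.refl HOL.refl, of a1 a2 a3 b1 b2 b3 q x1 x2 x3]
    by (elim insertE emptyE) (simp_all only: assms vol_zero add_0)
  have f: "x * F1 a1 b1 q x1 x2 x3 = 0" "x * F2 a2 b2 q x1 x2 x3 = 0" "x * F3 a3 b3 q x1 x2 x3 = 0"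
      "x * F4 q x1 x2 x3 = 0" for x
    by (simp_all add: assms)
  have "map (\<lambda>i. cubic (?R ! i) x1 x2 x3) [0..<16]
      = concat (map (\<lambda>x. [x * F1 a1 b1 q x1 x2 x3, x * F2 a2 b2 q x1 x2 x3,
     x * F3 a3 b3 q x1 x2 x3, x * F4 q x1 x2 x3]) [1, x1, x2, x3])"
    by (simp add: upt_rec dixon_rows_def cubic_def cubic_monomials_def
          F1_def F2_def F3_def F4_def algebra_simps power_numeral_reduce)
  also have "\<dots> = map (\<lambda>i. 0) [0..<16]" unfolding f by (simp add: upt_rec)
  finally have fs: "cubic (?R ! i) x1 x2 x3 = 0" if "i < 16" for i
    using that by (simp only: map_eq_conv set_upt) simp
  have rows: "cubic (?R ! i) x1 x2 x3 = 0" if "i < 20" for i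
  proof (cases "i < 16")
    case False
    then have "i \<in> {16, 17, 18, 19}" using that by auto
    then show ?thesis by (rule psi)
  qed (rule fs)
  have "?M *\<^sub>v v = 0\<^sub>v 20"
  proof (rule eq_vecI)
    fix i assume "i < dim_vec (0\<^sub>v 20 :: 'a vec)"
    then have i: "i < 20" by simp
    have len: "length (?R ! i) = 20" using dixon_rows_lengths[of a1 a2 a3 b1 b2 b3 q] i by simp
    have "(?M *\<^sub>v v) $ i = (\<Sum>j<20. ?R ! i ! j * (case cubic_monomials ! j of (i, k, l) \<Rightarrow> x1 ^ i
        * x2 ^ k * x3 ^ l))"
      using i carrier_matD[OF dixon_mat_carrier[of a1 a2 a3 b1 b2 b3 q]]
      by (simp add: scalar_prod_def v_def lessThan_atLeast0 dixon_mat_index del: sum.op_ivl_Suc)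
    also have "\<dots> = 0" unfolding cubic_eq_sum[OF len, symmetric] using rows[OF i] .
    finally show "(?M *\<^sub>v v) $ i = 0\<^sub>v 20 $ i" using i by simp
  qed (simp add: carrier_matD[OF dixon_mat_carrier])
  moreover have "v \<noteq> 0\<^sub>v 20"
  proof
    assume "v = 0\<^sub>v 20"
    then have "v $ 19 = 0" by simp
    moreover have "v $ 19 = 1" by (simp add: v_def cubic_monomials_def)
    ultimately show False by simp
  qed
  moreover have "v \<in> carrier_vec 20" by (simp add: v_def)
  ultimately show ?thesis using det_0_iff_vec_prod_zero[OF dixon_mat_carrier] by metis
qed


text \<open>At the four points \<open>(q0, \<plusminus>q0, \<plusminus>q0, \<plusminus>q0)\<close> with an even number of minus signs, \<open>x_i^2 = q0^2\<close>
  and \<open>x_1 x_2 = q0 x_3\<close>, \<open>x_1 x_3 = q0 x_2\<close>, \<open>x_2 x_3 = q0 x_1\<close>. Row \<open>l\<close> holds the coefficients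
  with which the \<open>l\<close>-th monomial of degree 2 or 3 reduces to \<open>x_1, x_2, x_3, 1\<close> under these rules.\<close>

definition four_point_residue :: "'a::comm_ring_1 \<Rightarrow> nat \<Rightarrow> nat \<Rightarrow> 'a" where
  "four_point_residue q l j = [
     [q^2, 0, 0, 0],
     [0, q^2, 0, 0],
     [0, 0, q^2, 0],
     [q^2, 0, 0, 0],
     [0, 0, 0, q^3],
     [q^2, 0, 0, 0],
     [0, q^2, 0, 0],
     [0, 0, q^2, 0],
     [0, q^2, 0, 0],
     [0, 0, q^2, 0],
     [0, 0, 0, q^2],
     [0, 0, q^1, 0],
     [0, q^1, 0, 0],
     [0, 0, 0, q^2],
     [q^1, 0, 0, 0],
     [0, 0, 0, q^2]] ! l ! j"

text \<open>The column operations given by the reduction rules replace each cubic by its restriction to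
  the four points. There \<open>f1, f2, f3\<close> vanish and \<open>f4\<close> equals \<open>4 q0^2 - 1\<close>; as all twenty cubics lie
  in the ideal generated by \<open>f1, ..., f4\<close>, the four new columns are divisible by \<open>4 q0^2 - 1\<close>.\<close>

lemma quadratic_factor_dvd_det:
  fixes q :: "'a::idom"
  shows "(4 * q^2 - 1) ^ 4 dvd det (dixon_mat a1 a2 a3 b1 b2 b3 q)"
proof (rule power_dvd_det_columns[where n = 16 and N = "four_point_residue q"])
  define R where "R = dixon_rows a1 a2 a3 b1 b2 b3 q"
  define C where "C = [
     [0, 0, 0, 0],
     [0, 0, 0, 0],
     [0, 0, 0, 0],
     [0, 0, 0, 1],
     [0, 0, 0, 0],
     [0, 0, 0, 0],
     [0, 0, 0, 0],
     [1, 0, 0, 0],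
     [0, 0, 0, 0],
     [0, 0, 0, 0],
     [0, 0, 0, 0],
     [0, 1, 0, 0],
     [0, 0, 0, 0],
     [0, 0, 0, 0],
     [0, 0, 0, 0],
     [0, 0, 1, 0],
     [4*a1*b2*b3*q^2, 4*a1*a2*b3*q^2 + 4*a3*b1*b2*q^2, 0, 4*a1*a2*a3*q^3],
     [4*a1*a2*a3*q - 8*b1*b2*b3*q, 4*a1*a3*b2*q, 0, 4*a1*b2*b3*q^2 - 4*a2*a3*b1*q^2],
     [0, 4*a1*a2*a3*q - 8*b1*b2*b3*q, 4*a1*b2*b3*q + 4*a2*a3*b1*q, 0],
     [4*a1*a2*b3*q + 4*a3*b1*b2*q, -4*a1*b2*b3*q, 4*a1*a2*a3*q, -4*a1*a3*b2*q^2]]"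
  have eq: "map (\<lambda>r. map (\<lambda>j. r ! (16 + j) + (\<Sum>l<16. r ! l * four_point_residue q l j)) [0, 1, 2, 3]) R
      = map (map ((*) (4 * q^2 - 1))) C"
    by (simp add: R_def C_def dixon_rows_def four_point_residue_def lessThan_nat_numeral lessThan_Suc
        algebra_simps power_numeral_reduce)
  show "dixon_mat a1 a2 a3 b1 b2 b3 q \<in> carrier_mat (16 + 4) (16 + 4)"
    using dixon_mat_carrier by simp
  fix i j :: nat assume ij: "i < 16 + 4" "j < 4"
  have j: "j = 0 \<or> j = 1 \<or> j = 2 \<or> j = 3" using ij by auto
  have len: "length R = 20" "length C = 20" "\<forall>r\<in>set C. length r = 4"
    by (simp_all add: R_def C_def dixon_rows_lengths)
  have "C ! i \<in> set C" by (rule nth_mem) (use ij len in simp)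
  then have "length (C ! i) = 4" using len(3) by blast
  moreover have "map (\<lambda>r. map (\<lambda>j. r ! (16 + j)
      + (\<Sum>l<16. r ! l * four_point_residue q l j)) [0, 1, 2, 3]) R ! i ! j
      = map (map ((*) (4 * q^2 - 1))) C ! i ! j" unfolding eq ..
  ultimately have "R ! i ! (16 + j) + (\<Sum>l<16. R ! i ! l * four_point_residue q l j) = (4 * q^2 - 1) * (C ! i ! j)"
    using ij len j by (elim disjE) simp_all
  then show "4 * q^2 - 1 dvd dixon_mat a1 a2 a3 b1 b2 b3 q $$ (i, 16 + j)
      + (\<Sum>l<16. dixon_mat a1 a2 a3 b1 b2 b3 q $$ (i, l) * four_point_residue q l j)"
    using ij by (simp add: dixon_mat_index flip: R_def)
qed

text \<open>If \<open>q0\<close> has weight one like \<open>x\<close> and \<open>y\<close>, then \<open>f1, ..., f4\<close> have total degree at most 2, their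
  multiples by \<open>x_i\<close> at most 3, and \<open>det U\<close> at most 5, which leaves 5 for \<open>\<psi>_000\<close> and 4 for the
  other three cubics. The degree in \<open>q0\<close> of an entry is bounded by the degree of its cubic minus the
  degree of its monomial; summed up, \<open>61 - 45 = 16\<close>.\<close>

lemma degree_det_system_Dix: "degree (det (system_Dix A1 A2 A3 B1 B2 B3)) \<le> 16"
proof -
  let ?R = "dixon_rows [:A1:] [:A2:] [:A3:] [:B1:] [:B2:] [:B3:] [:0, 1:]"
  let ?r = "[2,2,2,2, 3,3,3,3, 3,3,3,3, 3,3,3,3, 5,4,4,4] :: nat list"
  let ?c = "map (\<lambda>(i, j, k). i + j + k) cubic_monomials"
  have "list_all2 (\<lambda>r es. list_all2 (\<lambda>c e. short (Suc r - c) e) ?c es) ?r ?R"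
    by (simp add: dixon_rows_def cubic_monomials_def power_numeral_reduce numeral_poly one_pCons)
  then have "short (Suc (?r ! i) - ?c ! j) (?R ! i ! j)" if "i < 20" "j < 20" for i j
    using that by (auto simp: list_all2_conv_all_nth dixon_rows_lengths cubic_monomials_def simp del:
        nth_Cons_numeral)
  then have "degree (det (system_Dix A1 A2 A3 B1 B2 B3)) + (\<Sum>j<20. ?c ! j) \<le> (\<Sum>i<20. ?r ! i)
      \<or> det (system_Dix A1 A2 A3 B1 B2 B3) = 0"
    unfolding system_Dix_eq by (intro degree_det_le dixon_mat_carrier) (simp only: dixon_mat_index)
  moreover have "(\<Sum>j<20. ?c ! j) = 45" "(\<Sum>i<20. ?r ! i) = 61"
    by (simp_all add: cubic_monomials_def lessThan_nat_numeral lessThan_Suc)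
  ultimately show ?thesis by auto
qed

section \<open>The constant term of the Dixon determinant\<close>

lemma permutes_of_list:
  assumes "distinct ps" "set ps = {0..<n}"
  shows "(\<lambda>i. if i < n then ps ! i else i) permutes {0..<n}"
proof (rule bij_imp_permutes)
  have len: "length ps = n" using assms distinct_card[of ps] by simp
  then have "bij_betw ((!) ps) {0..<n} {0..<n}"
    using assms by (intro bij_betw_nth) (auto simp: lessThan_atLeast0)
  then show "bij_betw (\<lambda>i. if i < n then ps ! i else i) {0..<n} {0..<n}"
    by (rule bij_betw_cong[THEN iffD1, rotated]) simp
qed simp

lemma det_permute_rows_cols:
  assumes A: "A \<in> carrier_mat n n" and p: "p permutes {0..<n}" and q: "q permutes {0..<n}"
  shows "det (mat n n (\<lambda>(i, j). A $$ (p i, q j))) = signof p * signof q * det A"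
proof -
  let ?B = "mat n n (\<lambda>(i, j). A $$ (i, q j))"
  have p_less: "p i < n" if "i < n" for i using p that by (metis atLeastLessThan_iff permutes_in_image zero_le)
  have q_less: "q i < n" if "i < n" for i using q that by (metis atLeastLessThan_iff permutes_in_image zero_le)
  have "mat n n (\<lambda>(i, j). A $$ (p i, q j)) = mat n n (\<lambda>(i, j). ?B $$ (p i, j))"
    by (rule cong_mat) (simp_all add: p_less)
  then have "det (mat n n (\<lambda>(i, j). A $$ (p i, q j))) = signof p * det ?B"
    using det_permute_rows[of ?B n p] p by simp
  moreover have "det ?B = signof q * det A"
  proof -
    have "transpose_mat ?B = mat n n (\<lambda>(i, j). transpose_mat A $$ (q i, j))"
      using A q_less by (intro eq_matI) auto
    then have "det (transpose_mat ?B) = signof q * det (transpose_mat A)"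
      using det_permute_rows[of "transpose_mat A" n q] A q by simp
    then show ?thesis using det_transpose[OF A] det_transpose[of ?B n] by simp
  qed
  ultimately show ?thesis by simp
qed

lemma det_scale_rows:
  fixes A :: "'a::comm_ring_1 mat"
  assumes A: "A \<in> carrier_mat n n" and B: "B \<in> carrier_mat n n"
    and eq: "\<And>i j. i < n \<Longrightarrow> j < n \<Longrightarrow> B $$ (i, j) = c i * A $$ (i, j)"
  shows "det B = (\<Prod>i = 0..<n. c i) * det A"
proof -
  have "(\<Prod>i = 0..<n. B $$ (i, p i)) = (\<Prod>i = 0..<n. c i) * (\<Prod>i = 0..<n. A $$ (i, p i))"
      if "p permutes {0..<n}" for p
  proof -
    have "p i < n" if "i < n" for i using \<open>p permutes _\<close> that
        by (metis atLeastLessThan_iff permutes_in_image zero_le)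
    then show ?thesis by (simp add: eq prod.distrib)
  qed
  then show ?thesis
    unfolding det_def'[OF A] det_def'[OF B] sum_distrib_left by (intro sum.cong) (simp_all add: mult_ac)
qed

text \<open>Matrix multiplication by recursion over lists, so that a product with a sparse explicit matrix
  simplifies quickly.\<close>

fun row_combination :: "'a::comm_ring_1 list \<Rightarrow> 'a list list \<Rightarrow> 'a list" where
  "row_combination [] rs = replicate 20 0"
| "row_combination (c # cs) (r # rs) = map2 (\<lambda>x y. c * x + y) r (row_combination cs rs)"
| "row_combination (c # cs) [] = replicate 20 0"

lemma length_row_combination: "\<forall>r\<in>set rs. length r = 20 \<Longrightarrow> length (row_combination cs rs) = 20"
  by (induction cs rs rule: row_combination.induct) auto

lemma nth_row_combination:
  assumes "\<forall>r\<in>set rs. length r = 20" "length cs = length rs" "j < 20"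
  shows "row_combination cs rs ! j = (\<Sum>k<length rs. cs ! k * rs ! k ! j)"
  using assms
proof (induction cs rs rule: row_combination.induct)
  case (2 c cs r rs)
  then show ?case
    by (simp add: length_row_combination lessThan_Suc_eq_insert_0 sum.reindex del: sum.lessThan_Suc)
qed auto

text \<open>Gaussian elimination without divisions: the triangular matrix \<open>L\<close> records the row operations,
  which may rescale the rows, and \<open>U\<close> is the resulting echelon form.\<close>

lemma det_by_elimination:
  fixes N L U :: "'a::idom list list"
  assumes len: "length N = 20" "length L = 20" "length U = 20"
      "\<forall>r\<in>set N. length r = 20" "\<forall>r\<in>set L. length r = 20" "\<forall>r\<in>set U. length r = 20"
    and LN: "map (\<lambda>l. row_combination l N) L = U"
    and L: "\<And>i j. i < j \<Longrightarrow> j < 20 \<Longrightarrow> L ! i ! j = 0"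
    and U: "\<And>i j. j < i \<Longrightarrow> i < 20 \<Longrightarrow> U ! i ! j = 0"
  shows "(\<Prod>i\<leftarrow>[0..<20]. L ! i ! i) * det (mat_of_rows_list 20 N) = (\<Prod>i\<leftarrow>[0..<20]. U ! i ! i)"
proof -
  let ?m = "mat_of_rows_list 20 :: 'a list list \<Rightarrow> 'a mat"
  have carr: "?m N \<in> carrier_mat 20 20" "?m L \<in> carrier_mat 20 20" "?m U \<in> carrier_mat 20 20"
    unfolding mat_of_rows_list_def len by (rule mat_carrier)+
  have index: "i < 20 \<Longrightarrow> j < 20 \<Longrightarrow> ?m X $$ (i, j) = X ! i ! j" if "length X = 20" for X i j
    using that by (simp add: mat_of_rows_list_def)
  have "?m L * ?m N = ?m U"
  proof (rule eq_matI)
    fix i j assume "i < dim_row (?m U)" "j < dim_col (?m U)"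
    then have ij: "i < 20" "j < 20" using carr(3) by simp_all
    have "(?m L * ?m N) $$ (i, j) = (\<Sum>k<20. L ! i ! k * N ! k ! j)"
      using carr ij len by (simp add: scalar_prod_def lessThan_atLeast0 index)
    also have "\<dots> = row_combination (L ! i) N ! j"
      using ij len by (simp add: nth_row_combination)
    also have "\<dots> = ?m U $$ (i, j)"
      using ij len by (simp add: index flip: LN)
    finally show "(?m L * ?m N) $$ (i, j) = ?m U $$ (i, j)" .
  qed (use carr in auto)
  then have "det (?m L) * det (?m N) = det (?m U)" using det_mult[OF carr(2,1)] by simp
  moreover have "det (?m L) = (\<Prod>i\<leftarrow>[0..<20]. L ! i ! i)"
  proof -
    have "det (?m L) = prod_list (diag_mat (?m L))"
      by (rule det_lower_triangular[OF _ carr(2)]) (use carr(2) len L in \<open>auto simp: index\<close>)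
    moreover have "diag_mat (?m L) = map (\<lambda>i. L ! i ! i) [0..<20]"
      using carr(2) len by (auto simp: diag_mat_def index)
    ultimately show ?thesis by simp
  qed
  moreover have "det (?m U) = (\<Prod>i\<leftarrow>[0..<20]. U ! i ! i)"
  proof -
    have "upper_triangular (?m U)" using carr(3) len U by (auto simp: upper_triangular_def index)
    then have "det (?m U) = prod_list (diag_mat (?m U))" using carr(3) by (rule det_upper_triangular)
    moreover have "diag_mat (?m U) = map (\<lambda>i. U ! i ! i) [0..<20]"
      using carr(3) len by (auto simp: diag_mat_def index)
    ultimately show ?thesis by simp
  qed
  ultimately show ?thesis by simp
qed

text \<open>The order of the pivots. At \<open>q0 = 0\<close> the system is even in \<open>(x_1, x_2, x_3)\<close>, so the matrix
  decouples. The first four pivots are \<open>x_1, x_2, x_3, 1\<close> in the rows of \<open>x_i f4\<close> and \<open>f4\<close>, which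
  hold the only nonzero entries of these columns; then follow the six quadratic monomials and the
  ten cubic ones. In both groups \<open>f1 + f2\<close>, \<open>f1 + f3\<close>, \<open>f2 + f3\<close> eliminate the squares first, as
  each of these sums contains a single square when \<open>A1 = A2 = A3 = 1\<close>.\<close>

definition pivot_rows :: "nat list" where
  "pivot_rows = [7, 11, 15, 3, 2, 0, 1, 19, 18, 17, 6, 9, 12, 8, 14, 5, 13, 10, 4, 16]"

definition pivot_cols :: "nat list" where
  "pivot_cols = [16, 17, 18, 19, 10, 13, 15, 11, 12, 14, 0, 6, 9, 1, 7, 5, 2, 8, 3, 4]"

text \<open>After the elimination of the squares, the quadratic part is a 3 by 3 matrix of determinant
  \<open>-64 w3\<close> up to the order of its rows, with \<open>w3 = p q r + k^3\<close> for three trinomials \<open>p, q, r\<close> and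
  \<open>k = t1 t2 t3 - 1\<close>. The cubic part leads to the same polynomial, whence the square. The pivots
  \<open>4 k\<close> and \<open>2 k\<close> are the reason for the assumption; the power \<open>k^4\<close> that they contribute is also
  contributed by the rescaling of rows in \<open>L\<close>.\<close>

lemma det_pivoted:
  fixes t1 t2 t3 :: complex
  defines "R \<equiv> dixon_rows 1 1 1 t1 t2 t3 0" and "k \<equiv> t1 * t2 * t3 - 1"
  assumes "k \<noteq> 0"
  shows "det (mat_of_rows_list 20 (map (\<lambda>i. map (\<lambda>j. R ! i ! j) pivot_cols) pivot_rows))
      = 65536 * (w3 1 1 1 t1 t2 t3)^2"
proof -
  let ?N = "map (\<lambda>i. map (\<lambda>j. R ! i ! j) pivot_cols) pivot_rows"
  define L where "L =
   [[1, 0, 0, 0, 0, 0, 0, 0, 0, 0, 0, 0, 0, 0, 0, 0, 0, 0, 0, 0],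
    [0, 1, 0, 0, 0, 0, 0, 0, 0, 0, 0, 0, 0, 0, 0, 0, 0, 0, 0, 0],
    [0, 0, 1, 0, 0, 0, 0, 0, 0, 0, 0, 0, 0, 0, 0, 0, 0, 0, 0, 0],
    [0, 0, 0, 1, 0, 0, 0, 0, 0, 0, 0, 0, 0, 0, 0, 0, 0, 0, 0, 0],
    [0, 0, 0, 0, 1, 0, 0, 0, 0, 0, 0, 0, 0, 0, 0, 0, 0, 0, 0, 0],
    [0, 0, 0, 0, 1, 1, 0, 0, 0, 0, 0, 0, 0, 0, 0, 0, 0, 0, 0, 0],
    [0, 0, 0, 0, 1, 0, 1, 0, 0, 0, 0, 0, 0, 0, 0, 0, 0, 0, 0, 0],
    [0, 0, 0, 0, 2*t1*t3 + 2*t2, 2*t2, 2*t1*t3, 1, 0, 0, 0, 0, 0, 0, 0, 0, 0, 0, 0, 0],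
    [0, 0, 0, 0, 2*t1*t2, 2*t1*t2, 0, 0, 1, 0, 0, 0, 0, 0, 0, 0, 0, 0, 0, 0],
    [0, 0, 0, 0,
     2*t1^3*t2^2 + 2*t1^3*t2^2*t3^2 + 2*t1^2*t2^3*t3 + 2*t1 + 2*t1*t2^2 + 2*t1*t2^2*t3^2 + 2*t1*t3^2
         + 2*t2^3*t3 + 2*t2*t3,
     2*t1^3*t2^2 + 2*t1^3*t2^2*t3^2 + 2*t1^2*t2^3*t3 + 2*t1^2*t2*t3^3 + 2*t1^2*t2*t3 + 2*t1*t2^2
         + 4*t1*t2^2*t3^2 + 2*t2^3*t3,
     -2*t1^2*t2*t3^3 - 2*t1^2*t2*t3 + 2*t1 - 2*t1*t2^2*t3^2 + 2*t1*t3^2 + 2*t2*t3,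
     -(t1^2*t2^2*t3) - t1*t2^3*t3^2 + t1*t2 - t1*t2*t3^2 + t2^2*t3 + t3,
     t1^2*t2 + t1^2*t2*t3^2 + t1*t2^2*t3^3 + 2*t1*t2^2*t3 + t1*t3^3 + t1*t3 + t2^3*t3^2 + t2*t3^2,
     1 + t1^2*t2^2*t3^2 - 2*t1*t2*t3, 0, 0, 0, 0, 0, 0, 0, 0, 0, 0],
    [0, 0, 0, 0, 0, 0, 0, 0, 0, 0, 1, 0, 0, 0, 0, 0, 0, 0, 0, 0],
    [0, 0, 0, 0, 0, 0, 0, 0, 0, 0, 0, 1, 0, 0, 0, 0, 0, 0, 0, 0],
    [0, 0, 0, 0, 0, 0, 0, 0, 0, 0, 0, 0, 1, 0, 0, 0, 0, 0, 0, 0],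
    [0, 0, 0, 0, 0, 0, 0, 0, 0, 0, 0, 1, 0, 1, 0, 0, 0, 0, 0, 0],
    [0, 0, 0, 0, 0, 0, 0, 0, 0, 0, 0, 0, 1, 0, 1, 0, 0, 0, 0, 0],
    [0, 0, 0, 0, 0, 0, 0, 0, 0, 0, 1, t2, t1*t2, t2, t1*t2, 1, 0, 0, 0, 0],
    [0, 0, 0, 0, 0, 0, 0, 0, 0, 0, 0, 0, 1, 0, 0, 0, 1, 0, 0, 0],
    [0, 0, 0, 0, 0, 0, 0, 0, 0, 0, 0, 1, 0, 0, 0, 0, 0, 1, 0, 0],
    [0, 0, 0, 0, 0, 0, 0, 0, 0, 0, 1, t1*t3, t3, 0, 0, 0, t3, t1*t3, 1, 0],
    [0, 0, 0, 0, 0, 0, 0, 0, 0, 0,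
     2*t1^3*t2^2 + 2*t1^3*t2^2*t3^2 + 2*t1^2*t2^3*t3 + 2*t1 + 2*t1*t2^2 + 2*t1*t2^2*t3^2 + 2*t1*t3^2
         + 2*t2^3*t3 + 2*t2*t3,
     2*t1^3*t2 + 2*t1^3*t2*t3^2 + 2*t1^2*t2^2*t3 + 2*t1^2*t3^3 + 2*t1^2*t3 + 2*t1*t2 + 4*t1*t2*t3^2 + 2*t2^2*t3,
     2*t1^2*t2^3*t3^2 + 2*t1^2*t2 + 2*t1^2*t2*t3^2 + 2*t1*t2^2*t3^3 + 2*t1*t3^3 + 2*t1*t3
         + 2*t2^3*t3^2 + 2*t2 + 2*t2*t3^2,
     -2*t1^2*t2^2*t3^3 - 2*t1^2*t2^2*t3 - 2*t1*t2^3*t3^2 + 2*t1*t2 + 2*t1*t2*t3^2 + 2*t2^2*t3,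
     -2*t1^3*t2^2*t3 + 2*t1^2*t2 - 2*t1^2*t2*t3^2 - 2*t1*t2^2*t3 + 2*t1*t3 + 2*t2,
     -2*t1^2*t2*t3^3 - 2*t1^2*t2*t3 + 2*t1 - 2*t1*t2^2*t3^2 + 2*t1*t3^2 + 2*t2*t3,
     4*t1^3*t2^2*t3^3 + 2*t1^3*t2^2*t3 + 2*t1^2*t2^3*t3^2 - 4*t1^2*t2*t3^2 + 2*t1*t2^2*t3^3
         + 2*t1*t2^2*t3 + 2*t1*t3^3 + 4*t1*t3 + 2*t2^3*t3^2 + 2*t2*t3^2,
     2*t1^3*t2 + 2*t1^3*t2*t3^2 + 2*t1^2*t2^2*t3^3 + 4*t1^2*t2^2*t3 + 2*t1^2*t3^3 + 2*t1^2*t3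
         + 2*t1*t2^3*t3^2 + 2*t1*t2*t3^2,
     2*t1^3*t2^2 + 2*t1^3*t2^2*t3^2 + 2*t1^2*t2^3*t3 + 2*t1^2*t2*t3^3 + 2*t1^2*t2*t3 + 2*t1*t2^2
         + 4*t1*t2^2*t3^2 + 2*t2^3*t3,
     1 + t1^2*t2^2*t3^2 - 2*t1*t2*t3]]"
  define U where "U =
   [[-1, 0, 0, 0, 0, 0, 0, 0, 0, 0, 1, 0, 0, 0, 0, 1, 0, 0, 1, 0],
    [0, -1, 0, 0, 0, 0, 0, 0, 0, 0, 0, 1, 0, 1, 0, 0, 0, 1, 0, 0],
    [0, 0, -1, 0, 0, 0, 0, 0, 0, 0, 0, 0, 1, 0, 1, 0, 1, 0, 0, 0],
    [0, 0, 0, -1, 1, 1, 1, 0, 0, 0, 0, 0, 0, 0, 0, 0, 0, 0, 0, 0],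
    [0, 0, 0, 0, 1, -1, -1, 0, 2*t3, 0, 0, 0, 0, 0, 0, 0, 0, 0, 0, 0],
    [0, 0, 0, 0, 0, -2, 0, 0, 2*t3, 2*t1, 0, 0, 0, 0, 0, 0, 0, 0, 0, 0],
    [0, 0, 0, 0, 0, 0, -2, 2*t2, 2*t3, 0, 0, 0, 0, 0, 0, 0, 0, 0, 0, 0],
    [0, 0, 0, 0, 0, 0, 0, -4 + 4*t1*t2*t3, 4*t1 + 4*t1*t3^2 + 4*t2*t3, 0, 0, 0, 0, 0, 0, 0, 0, 0,
     0, 0],
    [0, 0, 0, 0, 0, 0, 0, 0, -4 + 4*t1*t2*t3, 4*t1^2*t2 + 4*t1*t3 + 4*t2, 0, 0, 0, 0, 0, 0, 0, 0,
     0, 0],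
    [0, 0, 0, 0, 0, 0, 0, 0, 0,
     -4 + 4*t1^4*t2^2 + 4*t1^4*t2^2*t3^2 + 8*t1^3*t2^3*t3^3 + 8*t1^3*t2^3*t3 + 8*t1^3*t2*t3^3
         + 8*t1^3*t2*t3 + 4*t1^2*t2^4*t3^2 + 4*t1^2*t2^2 + 4*t1^2*t2^2*t3^4 + 4*t1^2*t2^2*t3^2
             + 4*t1^2*t3^4 + 4*t1^2*t3^2 + 8*t1*t2^3*t3^3 + 8*t1*t2^3*t3 + 8*t1*t2*t3^3 + 16*t1*t2*t3
                 + 4*t2^4*t3^2 + 4*t2^2*t3^2,
     0, 0, 0, 0, 0, 0, 0, 0, 0, 0],
    [0, 0, 0, 0, 0, 0, 0, 0, 0, 0, 1, 0, 0, 0, 0, -1, 2*t3, 0, -1, 0],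
    [0, 0, 0, 0, 0, 0, 0, 0, 0, 0, 0, 1, 0, -1, 0, 0, 0, -1, 2*t2, 0],
    [0, 0, 0, 0, 0, 0, 0, 0, 0, 0, 0, 0, 1, 0, -1, 0, -1, 2*t1, 0, 0],
    [0, 0, 0, 0, 0, 0, 0, 0, 0, 0, 0, 0, 0, -2, 2*t1, 0, 0, 0, 2*t2, 0],
    [0, 0, 0, 0, 0, 0, 0, 0, 0, 0, 0, 0, 0, 0, -2, 2*t3, 0, 2*t1, 0, 0],
    [0, 0, 0, 0, 0, 0, 0, 0, 0, 0, 0, 0, 0, 0, 0, -2 + 2*t1*t2*t3, 2*t3, 2*t1^2*t2, 2*t2^2, 0],
    [0, 0, 0, 0, 0, 0, 0, 0, 0, 0, 0, 0, 0, 0, 0, 0, -2, 2*t1, 0, 2*t2],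
    [0, 0, 0, 0, 0, 0, 0, 0, 0, 0, 0, 0, 0, 0, 0, 0, 0, -2, 2*t2, 2*t3],
    [0, 0, 0, 0, 0, 0, 0, 0, 0, 0, 0, 0, 0, 0, 0, 0, 0, 0, -2 + 2*t1*t2*t3,
     2*t1 + 2*t1*t3^2 + 2*t2*t3],
    [0, 0, 0, 0, 0, 0, 0, 0, 0, 0, 0, 0, 0, 0, 0, 0, 0, 0, 0,
     -4 + 4*t1^4*t2^2 + 4*t1^4*t2^2*t3^2 + 8*t1^3*t2^3*t3^3 + 8*t1^3*t2^3*t3 + 8*t1^3*t2*t3^3
         + 8*t1^3*t2*t3 + 4*t1^2*t2^4*t3^2 + 4*t1^2*t2^2 + 4*t1^2*t2^2*t3^4 + 4*t1^2*t2^2*t3^2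
             + 4*t1^2*t3^4 + 4*t1^2*t3^2 + 8*t1*t2^3*t3^3 + 8*t1*t2^3*t3 + 8*t1*t2*t3^3 + 16*t1*t2*t3
                 + 4*t2^4*t3^2 + 4*t2^2*t3^2]]"
  have N: "?N =
   [[-1, 0, 0, 0, 0, 0, 0, 0, 0, 0, 1, 0, 0, 0, 0, 1, 0, 0, 1, 0],
    [0, -1, 0, 0, 0, 0, 0, 0, 0, 0, 0, 1, 0, 1, 0, 0, 0, 1, 0, 0],
    [0, 0, -1, 0, 0, 0, 0, 0, 0, 0, 0, 0, 1, 0, 1, 0, 1, 0, 0, 0],
    [0, 0, 0, -1, 1, 1, 1, 0, 0, 0, 0, 0, 0, 0, 0, 0, 0, 0, 0, 0],
    [0, 0, 0, 0, 1, -1, -1, 0, 2*t3, 0, 0, 0, 0, 0, 0, 0, 0, 0, 0, 0],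
    [0, 0, 0, 0, -1, -1, 1, 0, 0, 2*t1, 0, 0, 0, 0, 0, 0, 0, 0, 0, 0],
    [0, 0, 0, 0, -1, 1, -1, 2*t2, 0, 0, 0, 0, 0, 0, 0, 0, 0, 0, 0, 0],
    [0, 0, 0, 0, 0, 4*t2, 4*t1*t3, -4, 4*t1, -4*t1*t2, 0, 0, 0, 0, 0, 0, 0, 0, 0, 0],
    [0, 0, 0, 0, 0, 4*t1*t2, 0, 0, -4, 4*t1*t3 + 4*t2, 0, 0, 0, 0, 0, 0, 0, 0, 0, 0],
    [0, 0, 0, 0, 0, -4*t2*t3, 4*t1 + 4*t2*t3, 4*t3, -4*t1*t3, -4 + 8*t1*t2*t3, 0, 0, 0, 0, 0, 0,
     0, 0, 0, 0],
    [0, 0, 0, 0, 0, 0, 0, 0, 0, 0, 1, 0, 0, 0, 0, -1, 2*t3, 0, -1, 0],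
    [0, 0, 0, 0, 0, 0, 0, 0, 0, 0, 0, 1, 0, -1, 0, 0, 0, -1, 2*t2, 0],
    [0, 0, 0, 0, 0, 0, 0, 0, 0, 0, 0, 0, 1, 0, -1, 0, -1, 2*t1, 0, 0],
    [0, 0, 0, 0, 0, 0, 0, 0, 0, 0, 0, -1, 0, -1, 2*t1, 0, 0, 1, 0, 0],
    [0, 0, 0, 0, 0, 0, 0, 0, 0, 0, 0, 0, -1, 0, -1, 2*t3, 1, 0, 0, 0],
    [0, 0, 0, 0, 0, 0, 0, 0, 0, 0, -1, 0, 0, 2*t2, 0, -1, 0, 0, 1, 0],
    [0, 0, 0, 0, 0, 0, 0, 0, 0, 0, 0, 0, -1, 0, 1, 0, -1, 0, 0, 2*t2],
    [0, 0, 0, 0, 0, 0, 0, 0, 0, 0, 0, -1, 0, 1, 0, 0, 0, -1, 0, 2*t3],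
    [0, 0, 0, 0, 0, 0, 0, 0, 0, 0, -1, 0, 0, 0, 0, 1, 0, 0, -1, 2*t1],
    [0, 0, 0, 0, 0, 0, 0, 0, 0, 0, 0, 0, 4*t1*t3, 0, 4*t2, 4*t1, 0, -4*t1*t2, 0, -4]]"
    by (simp add: R_def dixon_rows_def pivot_rows_def pivot_cols_def)
  have LN: "map (\<lambda>l. row_combination l ?N) L = U"
  proof -
    have z: "replicate 20 (0::complex) = [0,0,0,0,0,0,0,0,0,0,0,0,0,0,0,0,0,0,0,0]"
      by (simp add: numeral_eq_Suc)
    show ?thesis unfolding N L_def U_def
      by (simp add: z) (simp add: algebra_simps power_numeral_reduce)
  qed
  have upt: "[0..<20] = [0,1,2,3,4,5,6,7,8,9,10,11,12,13,14,15,16,17,18,19]" by code_simp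
  have "\<forall>i\<in>set [0..<20]. set (drop (Suc i) (L ! i)) \<subseteq> {0}"
    "\<forall>i\<in>set [0..<20]. set (take i (U ! i)) \<subseteq> {0}"
    unfolding upt by (simp_all add: L_def U_def)
  then have tri: "i < 20 \<Longrightarrow> x \<in> set (drop (Suc i) (L ! i)) \<Longrightarrow> x = 0"
    "i < 20 \<Longrightarrow> x \<in> set (take i (U ! i)) \<Longrightarrow> x = 0" for i x
    unfolding set_upt by fastforce+
  have len: "length L = 20" "length U = 20" "\<forall>r\<in>set L. length r = 20" "\<forall>r\<in>set U. length r = 20"
    "length ?N = 20" "\<forall>r\<in>set ?N. length r = 20"
    by (simp_all add: L_def U_def pivot_rows_def pivot_cols_def)
  have lenLU: "i < 20 \<Longrightarrow> length (L ! i) = 20" "i < 20 \<Longrightarrow> length (U ! i) = 20" for i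
    using len(1-4) by (metis nth_mem)+
  have "(\<Prod>i\<leftarrow>[0..<20]. L ! i ! i) * det (mat_of_rows_list 20 ?N) = (\<Prod>i\<leftarrow>[0..<20]. U ! i ! i)"
  proof (rule det_by_elimination[OF len(5,1,2,6,3,4) LN])
    fix i j :: nat assume ij: "i < j" "j < 20"
    then have "L ! i ! j = drop (Suc i) (L ! i) ! (j - Suc i)" "j - Suc i < length (drop (Suc i) (L ! i))"
      using lenLU(1)[of i] by simp_all
    then show "L ! i ! j = 0" using tri(1)[of i "L ! i ! j"] ij by (metis less_trans nth_mem)
  next
    fix i j :: nat assume ij: "j < i" "i < 20"
    then have "U ! i ! j = take i (U ! i) ! j" "j < length (take i (U ! i))"
      using lenLU(2)[of i] by simp_all
    then show "U ! i ! j = 0" using tri(2)[of i "U ! i ! j"] ij by (metis nth_mem)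
  qed
  moreover have "(\<Prod>i\<leftarrow>[0..<20]. L ! i ! i) = k ^ 4"
    unfolding upt by (simp add: L_def k_def algebra_simps power_numeral_reduce)
  moreover have "(\<Prod>i\<leftarrow>[0..<20]. U ! i ! i) = 65536 * k ^ 4 * (w3 1 1 1 t1 t2 t3)^2"
  proof -
    have d: "U ! 9 ! 9 = 4 * w3 1 1 1 t1 t2 t3" "U ! 19 ! 19 = 4 * w3 1 1 1 t1 t2 t3"
      "U ! 7 ! 7 = 4 * k" "U ! 8 ! 8 = 4 * k" "U ! 15 ! 15 = 2 * k" "U ! 18 ! 18 = 2 * k"
      by (simp_all add: U_def w3_def k_def algebra_simps)
    show ?thesis unfolding upt
      by (simp add: d power_numeral_reduce) (simp add: U_def)
  qed
  ultimately show ?thesis using assms(3) by simp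
qed

text \<open>The rows are homogeneous in each pair \<open>(A_i, B_i)\<close>, so for \<open>A_i \<noteq> 0\<close> the parameters can be
  scaled to \<open>(1, t_i)\<close> with \<open>t_i = B_i / A_i\<close>. The sign \<open>s\<close> is that of the permutations which order
  the pivots; only its independence of the parameters matters.\<close>

lemma det_dixon_mat_0:
  "\<exists>s. (s = 1 \<or> s = -1) \<and> (\<forall>A1 A2 A3 B1 B2 B3 :: complex.
     A1 * A2 * A3 \<noteq> 0 \<and> B1 * B2 * B3 - A1 * A2 * A3 \<noteq> 0 \<longrightarrow>
     det (dixon_mat A1 A2 A3 B1 B2 B3 0) = s * (65536 * (w3 A1 A2 A3 B1 B2 B3)^2))"
proof -
  define p where "p i = (if i < 20 then pivot_rows ! i else i)" for i
  define q where "q i = (if i < 20 then pivot_cols ! i else i)" for i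
  have "set pivot_rows = {0..<20}" "set pivot_cols = {0..<20}" "distinct pivot_rows" "distinct pivot_cols"
    by code_simp+
  then have p: "p permutes {0..<20}" and q: "q permutes {0..<20}"
    unfolding p_def q_def by (simp_all add: permutes_of_list)
  define s :: complex where "s = signof p * signof q"
  have s: "s = 1 \<or> s = -1" by (auto simp: s_def sign_def)
  have "det (dixon_mat A1 A2 A3 B1 B2 B3 0) = s * (65536 * (w3 A1 A2 A3 B1 B2 B3)^2)"
    if nz: "A1 * A2 * A3 \<noteq> 0" "B1 * B2 * B3 - A1 * A2 * A3 \<noteq> 0" for A1 A2 A3 B1 B2 B3 :: complex
  proof -
    define t1 t2 t3 where "t1 = B1 / A1" and "t2 = B2 / A2" and "t3 = B3 / A3"
    have B: "B1 = A1 * t1" "B2 = A2 * t2" "B3 = A3 * t3" using nz by (simp_all add: t1_def t2_def t3_def)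
    have "A1 * A2 * A3 * (t1 * t2 * t3 - 1) \<noteq> 0" using nz(2) by (simp add: B algebra_simps)
    then have k: "t1 * t2 * t3 - 1 \<noteq> 0" by auto
    let ?M = "dixon_mat 1 1 1 t1 t2 t3 0" and ?R = "dixon_rows 1 1 1 t1 t2 t3 0"
    let ?N = "map (\<lambda>i. map (\<lambda>j. ?R ! i ! j) pivot_cols) pivot_rows"
    have "mat_of_rows_list 20 ?N = mat 20 20 (\<lambda>(i, j). ?M $$ (p i, q j))"
    proof (rule eq_matI)
      have len: "length pivot_rows = 20" "length pivot_cols = 20" by (simp_all add: pivot_rows_def pivot_cols_def)
      fix i j assume "i < dim_row (mat 20 20 (\<lambda>(i, j). ?M $$ (p i, q j)))"
          "j < dim_col (mat 20 20 (\<lambda>(i, j). ?M $$ (p i, q j)))"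
      then have ij: "i < 20" "j < 20" by simp_all
      have pq: "p i < 20" "q j < 20"
        using p q ij by (metis atLeastLessThan_iff permutes_in_image zero_le)+
      then show "mat_of_rows_list 20 ?N $$ (i, j) = mat 20 20 (\<lambda>(i, j). ?M $$ (p i, q j)) $$ (i, j)"
        using ij len by (simp add: mat_of_rows_list_def dixon_mat_index) (simp add: p_def q_def)
    qed (simp_all add: mat_of_rows_list_def pivot_rows_def)
    then have "65536 * (w3 1 1 1 t1 t2 t3)^2 = s * det ?M"
      using det_pivoted[OF k] det_permute_rows_cols[OF dixon_mat_carrier p q, of 1 1 1 t1 t2 t3 0]
          by (simp add: s_def)
    then have M: "det ?M = s * (65536 * (w3 1 1 1 t1 t2 t3)^2)" using s by auto
    define cs where "cs = concat (replicate 4 [A1, A2, A3, 1]) @ replicate 4 (A1 * A2 * A3)"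
    have cs: "cs = [A1, A2, A3, 1, A1, A2, A3, 1, A1, A2, A3, 1, A1, A2, A3, 1, A1*A2*A3, A1*A2*A3,
        A1*A2*A3, A1*A2*A3]"
      by (simp add: cs_def numeral_eq_Suc)
    have len_cs: "length cs = 20" by (simp add: cs)
    have rows: "dixon_rows A1 A2 A3 B1 B2 B3 0 = map2 (\<lambda>c r. map ((*) c) r) cs ?R"
      by (simp add: cs B dixon_rows_def algebra_simps)
    have "det (dixon_mat A1 A2 A3 B1 B2 B3 0) = (\<Prod>i = 0..<20. cs ! i) * det ?M"
    proof (rule det_scale_rows[OF dixon_mat_carrier dixon_mat_carrier])
      fix i j :: nat assume ij: "i < 20" "j < 20"
      show "dixon_mat A1 A2 A3 B1 B2 B3 0 $$ (i, j) = cs ! i * ?M $$ (i, j)"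
        using ij len_cs dixon_rows_lengths[of 1 1 1 t1 t2 t3 0] by (simp add: dixon_mat_index rows)
    qed
    also have "(\<Prod>i = 0..<20. cs ! i) = (A1 * A2 * A3) ^ 8"
    proof -
      have "(\<Prod>i = 0..<20. cs ! i) = prod_list cs"
        using len_cs by (simp add: prod.list_conv_set_nth)
      also have "\<dots> = (A1 * A2 * A3) ^ 8" by (simp add: cs power_numeral_reduce mult_ac)
      finally show ?thesis .
    qed
    also have "(A1 * A2 * A3) ^ 8 * det ?M = s * (65536 * ((A1 * A2 * A3) ^ 4 * w3 1 1 1 t1 t2 t3)^2)"
      unfolding M by (simp add: power_mult_distrib)
    also have "(A1 * A2 * A3) ^ 4 * w3 1 1 1 t1 t2 t3 = w3 A1 A2 A3 B1 B2 B3"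
      unfolding B w3_def by (simp add: algebra_simps power_numeral_reduce)
    finally show ?thesis .
  qed
  then show ?thesis using s by blast
qed

section \<open>The solutions of the system\<close>

text \<open>The polynomial \<open>G\<close> in terms of \<open>y = 4 q0^2 - 1\<close>, normalised to leading coefficient \<open>w^2\<close>: the
  product of \<open>r1 r2 r3 y - k \<sigma>\<close> over the four values of \<open>\<sigma> = \<plusminus> B1 r3 \<plusminus> B2 r1 \<plusminus> B3 r2\<close>, in which only
  the squares of \<open>r1, r2, r3\<close> are left. Here \<open>a2, b2, c2\<close> are the squares of \<open>B1 r3, B2 r1, B3 r2\<close>.\<close>

definition quartic_form :: "complex \<Rightarrow> complex \<Rightarrow> complex \<Rightarrow> complex \<Rightarrow> complex \<Rightarrow> complex \<Rightarrow> complex \<Rightarrow> complex" where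
  "quartic_form A1 A2 A3 B1 B2 B3 y =
     (let al = A1^2 * A3^2 + B1^2 * A3^2 + B1^2 * B3^2;
          be = A1^2 * A2^2 + A1^2 * B2^2 + B1^2 * B2^2;
          ga = A2^2 * A3^2 + A2^2 * B3^2 + B2^2 * B3^2;
          T = B1 * B2 * B3; k = T - A1 * A2 * A3;
          a2 = B1^2 * ga; b2 = B2^2 * al; c2 = B3^2 * be;
          W = al * be * ga
      in W^2 * y^4 - 2 * k^2 * (a2 + b2 + c2) * W * y^2 - 8 * k^3 * T * W * y
         + k^4 * (a2^2 + b2^2 + c2^2 - 2*a2*b2 - 2*b2*c2 - 2*a2*c2))"

text \<open>The long polynomials have short expressions: with \<open>T = B1 B2 B3\<close>, \<open>P = A1 A2 A3\<close>, \<open>k = T - P\<close>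
  and \<open>S = a2 + b2 + c2\<close>, \<open>w1 = 3 w - k^2 S\<close>, \<open>w2 = w - k^2 S + 2 k^3 T\<close> and
  \<open>w3 = w - k^2 S + 2 k^3 (T + P)\<close>. That the constant term is \<open>w3^2\<close> then needs one relation between
  \<open>w\<close> and \<open>a2, b2, c2\<close>. It comes from \<open>a2 b2 c2 = T^2 w\<close> and \<open>(a2 - \<pi>) (b2 - \<pi>) (c2 - \<pi>) = P^2 w\<close>
  with \<open>\<pi> = T^2 - P^2 = k (T + P)\<close>, whose difference is divisible by \<open>\<pi>\<close>.\<close>

lemma poly_G:
  "poly (G A1 A2 A3 B1 B2 B3) x = - 65536 * quartic_form A1 A2 A3 B1 B2 B3 (4 * x^2 - 1)"
proof -
  define al be ga T k a2 b2 c2 W S where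
    "al = A1^2 * A3^2 + B1^2 * A3^2 + B1^2 * B3^2" and
    "be = A1^2 * A2^2 + A1^2 * B2^2 + B1^2 * B2^2" and
    "ga = A2^2 * A3^2 + A2^2 * B3^2 + B2^2 * B3^2" and
    "T = B1 * B2 * B3" and "k = T - A1 * A2 * A3" and
    "a2 = B1^2 * ga" and "b2 = B2^2 * al" and "c2 = B3^2 * be" and
    "W = al * be * ga" and "S = a2 + b2 + c2"
  note defs = al_def be_def ga_def T_def k_def a2_def b2_def c2_def W_def S_def
  have w: "w A1 A2 A3 B1 B2 B3 = W"
    unfolding w_def defs by (simp add: mult_ac)
  have w1: "w1 A1 A2 A3 B1 B2 B3 = 3 * W - k^2 * S"
    unfolding w1_def defs by (simp add: algebra_simps power_numeral_reduce)
  have w2: "w2 A1 A2 A3 B1 B2 B3 = W - k^2 * S + 2 * k^3 * T"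
    unfolding w2_def defs by (simp add: algebra_simps power_numeral_reduce)
  have w3: "w3 A1 A2 A3 B1 B2 B3 = W - k^2 * S + 2 * k^3 * (T + A1 * A2 * A3)"
    unfolding w3_def defs by (simp add: algebra_simps power_numeral_reduce)
  have W: "W = a2*b2 + b2*c2 + a2*c2 - k * (T + A1 * A2 * A3) * S + (k * (T + A1 * A2 * A3))^2"
    unfolding defs by (simp add: algebra_simps power_numeral_reduce)
  have square: "(W - k^2 * S + 2 * k^3 * k')^2 = W^2 - 2 * k^2 * S * W + 8 * k^3 * T * W
      + k^4 * (a2^2 + b2^2 + c2^2 - 2*a2*b2 - 2*b2*c2 - 2*a2*c2)"
    if "k' = 2 * T - k" "W = a2*b2 + b2*c2 + a2*c2 - k * k' * S + (k * k')^2" for k'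
  proof -
    have "a2^2 + b2^2 + c2^2 - 2*a2*b2 - 2*b2*c2 - 2*a2*c2 = S^2 - 4 * (a2*b2 + b2*c2 + a2*c2)"
      unfolding S_def by (simp add: algebra_simps power2_eq_square)
    also have "a2*b2 + b2*c2 + a2*c2 = W + k * k' * S - (k * k')^2" using that(2) by simp
    finally have Hr: "a2^2 + b2^2 + c2^2 - 2*a2*b2 - 2*b2*c2 - 2*a2*c2 = S^2 - 4 * (W + k * k' * S - (k * k')^2)" .
    show ?thesis unfolding Hr that(1) by (simp add: algebra_simps power_numeral_reduce)
  qed
  have w3_sq: "(w3 A1 A2 A3 B1 B2 B3)^2 = W^2 - 2 * k^2 * S * W + 8 * k^3 * T * W
      + k^4 * (a2^2 + b2^2 + c2^2 - 2*a2*b2 - 2*b2*c2 - 2*a2*c2)"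
    unfolding w3 by (rule square[OF _ W]) (simp add: k_def)
  have "poly (G A1 A2 A3 B1 B2 B3) x = -16777216 * W^2 * x^8 + 16777216 * W^2 * x^6
      - 2097152 * W * (3 * W - k^2 * S) * x^4 + 1048576 * W * (W - k^2 * S + 2 * k^3 * T) * x^2
      - 65536 * (W^2 - 2 * k^2 * S * W + 8 * k^3 * T * W
      + k^4 * (a2^2 + b2^2 + c2^2 - 2*a2*b2 - 2*b2*c2 - 2*a2*c2))"
    unfolding G_def Let_def w w1 w2 w3_sq by (simp add: poly_monom)
  also have "\<dots> = - 65536 * (W^2 * (4*x^2 - 1)^4 - 2 * k^2 * S * W * (4*x^2 - 1)^2 - 8 * k^3 * T * W * (4*x^2 - 1)
         + k^4 * (a2^2 + b2^2 + c2^2 - 2*a2*b2 - 2*b2*c2 - 2*a2*c2))"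
    by (simp add: algebra_simps power_numeral_reduce)
  also have "\<dots> = - 65536 * quartic_form A1 A2 A3 B1 B2 B3 (4 * x^2 - 1)"
    unfolding quartic_form_def Let_def defs ..
  finally show ?thesis .
qed


lemma quartic_form_factored:
  assumes r1: "r1^2 = A1^2 * A3^2 + B1^2 * A3^2 + B1^2 * B3^2"
    and r2: "r2^2 = A1^2 * A2^2 + A1^2 * B2^2 + B1^2 * B2^2"
    and r3: "r3^2 = A2^2 * A3^2 + A2^2 * B3^2 + B2^2 * B3^2"
    and k: "k = B1 * B2 * B3 - A1 * A2 * A3"
  shows "quartic_form A1 A2 A3 B1 B2 B3 y =
     (r1 * r2 * r3 * y - k * (B1 * r3 + B2 * r1 + B3 * r2)) *
     (r1 * r2 * r3 * y - k * (- B1 * r3 - B2 * r1 + B3 * r2)) *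
     (r1 * r2 * r3 * y - k * (B1 * r3 - B2 * r1 - B3 * r2)) *
     (r1 * r2 * r3 * y - k * (- B1 * r3 + B2 * r1 - B3 * r2))"
  unfolding quartic_form_def Let_def r1[symmetric] r2[symmetric] r3[symmetric] k[symmetric]
      by (simp add: algebra_simps power_numeral_reduce)

text \<open>The four solutions of \<open>f1 = f2 = f3 = 0\<close> outside the coordinate points. With \<open>a, b, c\<close> half
  the sums and \<open>a', b', c'\<close> half the differences of the opposite products \<open>X_ij\<close>, the equations
  become \<open>A1 a = B1 c'\<close>, \<open>A2 b = B2 a'\<close>, \<open>A3 c = B3 b'\<close>, and the definitions of \<open>r1, r2, r3\<close> make
  the three products of opposite \<open>X_ij\<close> equal. Hence a point \<open>u\<close> with \<open>u_i u_j\<close> proportional to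
  \<open>X_ij\<close> exists. The hypothesis on \<open>x\<close> says that \<open>q0^2 = x^2 |q|^2\<close> at this point, so scaling it to
  \<open>q0 = x\<close> gives \<open>f4 = 0\<close>.\<close>

lemma solution_from_root:
  fixes A1 A2 A3 B1 B2 B3 x :: complex
  assumes r1: "r1^2 = A1^2 * A3^2 + B1^2 * A3^2 + B1^2 * B3^2"
    and r2: "r2^2 = A1^2 * A2^2 + A1^2 * B2^2 + B1^2 * B2^2"
    and r3: "r3^2 = A2^2 * A3^2 + A2^2 * B3^2 + B2^2 * B3^2"
    and k: "k = B1 * B2 * B3 - A1 * A2 * A3" "k \<noteq> 0" "B1 * B2 * B3 + A1 * A2 * A3 \<noteq> 0"
    and nz: "r1 * r2 * r3 \<noteq> 0" "x \<noteq> 0"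
    and root: "r1 * r2 * r3 * (4 * x^2 - 1) = k * (B1 * r3 + B2 * r1 + B3 * r2)"
  shows "\<exists>x1 x2 x3. F1 A1 B1 x x1 x2 x3 = 0 \<and> F2 A2 B2 x x1 x2 x3 = 0 \<and> F3 A3 B3 x x1 x2 x3
      = 0 \<and> F4 x x1 x2 x3 = 0"
proof -
  define a b c a' b' c' where "a = B1 * r3" and "b = B2 * r1" and "c = B3 * r2"
    and "a' = A2 * r1" and "b' = A3 * r2" and "c' = A1 * r3"
  define X01 X23 X02 X13 X03 X12 where "X01 = a + a'" and "X23 = a - a'" and "X02 = b + b'" and "X13 = b - b'"
    and "X03 = c + c'" and "X12 = c - c'"
  define \<pi> where "\<pi> = k * (B1 * B2 * B3 + A1 * A2 * A3)"
  define \<rho> where "\<rho> = r1 * r2 * r3"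
  have sq: "a^2 - a'^2 = \<pi>" "b^2 - b'^2 = \<pi>" "c^2 - c'^2 = \<pi>"
    unfolding a_def a'_def b_def b'_def c_def c'_def \<pi>_def power_mult_distrib r1 r2 r3 k(1)
        by (simp_all add: algebra_simps power_numeral_reduce)
  have X: "X01 * X23 = \<pi>" "X02 * X13 = \<pi>" "X03 * X12 = \<pi>"
    using sq by (simp_all add: X01_def X23_def X02_def X13_def X03_def X12_def algebra_simps power2_eq_square)
  have "\<pi> \<noteq> 0" using k by (simp add: \<pi>_def)
  then have X_nz: "X01 \<noteq> 0" "X02 \<noteq> 0" "X12 \<noteq> 0" using X by auto
  \<comment> \<open>A point with \<open>u_i u_j = X_ij\<close>, multiplied by \<open>u0 X12\<close> to avoid its square roots.\<close>
  define u0 u1 u2 u3 where "u0 = X01 * X02" and "u1 = X01 * X12" and "u2 = X02 * X12" and "u3 = X03 * X12"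
  define \<mu> where "\<mu> = X01 * X02 * X12"
  have "\<mu> \<noteq> 0" using X_nz by (simp add: \<mu>_def)
  have uu: "u0 * u1 = \<mu> * X01" "u0 * u2 = \<mu> * X02" "u1 * u2 = \<mu> * X12" "u0 * u3 = \<mu> * X03"
     "u2 * u3 = \<mu> * X23" "u1 * u3 = \<mu> * X13"
  proof -
    show "u0 * u1 = \<mu> * X01" "u0 * u2 = \<mu> * X02" "u1 * u2 = \<mu> * X12" "u0 * u3 = \<mu> * X03"
      by (simp_all add: u0_def u1_def u2_def u3_def \<mu>_def)
    have "u2 * u3 = (X03 * X12) * (X02 * X12)" "u1 * u3 = (X03 * X12) * (X01 * X12)"
      by (simp_all add: u1_def u2_def u3_def)
    then have "u2 * u3 = (X01 * X23) * (X02 * X12)" "u1 * u3 = (X02 * X13) * (X01 * X12)"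
      unfolding X by simp_all
    then show "u2 * u3 = \<mu> * X23" "u1 * u3 = \<mu> * X13" by (simp_all add: \<mu>_def)
  qed
  define q0 q1 q2 q3 where "q0 = u0 + u1 + u2 + u3" and "q1 = u0 - u1 - u2 + u3"
    and "q2 = u0 - u1 + u2 - u3" and "q3 = u0 + u1 - u2 - u3"
  note q_defs = q0_def q1_def q2_def q3_def
  have f1: "F1 A1 B1 q0 q1 q2 q3 = 0"
  proof -
    have "F1 A1 B1 q0 q1 q2 q3 = 8 * (A1 * (u0 * u1 + u2 * u3) - B1 * (u0 * u3 - u1 * u2))"
      unfolding F1_def q_defs by (simp add: algebra_simps power2_eq_square)
    also have "\<dots> = 8 * \<mu> * (A1 * (X01 + X23) - B1 * (X03 - X12))" unfolding uu by (simp add: algebra_simps)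
    also have "\<dots> = 0" by (simp add: X01_def X23_def X03_def X12_def a_def c'_def)
    finally show ?thesis .
  qed
  have f2: "F2 A2 B2 q0 q1 q2 q3 = 0"
  proof -
    have "F2 A2 B2 q0 q1 q2 q3 = 8 * (A2 * (u0 * u2 + u1 * u3) - B2 * (u0 * u1 - u2 * u3))"
      unfolding F2_def q_defs by (simp add: algebra_simps power2_eq_square)
    also have "\<dots> = 8 * \<mu> * (A2 * (X02 + X13) - B2 * (X01 - X23))" unfolding uu by (simp add: algebra_simps)
    also have "\<dots> = 0" by (simp add: X01_def X23_def X02_def X13_def b_def a'_def)
    finally show ?thesis .
  qed
  have f3: "F3 A3 B3 q0 q1 q2 q3 = 0"
  proof -
    have "F3 A3 B3 q0 q1 q2 q3 = 8 * (A3 * (u0 * u3 + u1 * u2) - B3 * (u0 * u2 - u1 * u3))"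
      unfolding F3_def q_defs by (simp add: algebra_simps power2_eq_square)
    also have "\<dots> = 8 * \<mu> * (A3 * (X03 + X12) - B3 * (X02 - X13))" unfolding uu by (simp add: algebra_simps)
    also have "\<dots> = 0" by (simp add: X03_def X12_def X02_def X13_def c_def b'_def)
    finally show ?thesis .
  qed
  define N where "N = u0^2 + u1^2 + u2^2 + u3^2"
  have norm: "q0^2 + q1^2 + q2^2 + q3^2 = 4 * N"
    unfolding q_defs N_def by (simp add: algebra_simps power2_eq_square)
  \<comment> \<open>Here \<open>\<pi> u_i^2\<close> is \<open>\<mu>\<close> times the product of the three \<open>X_ij\<close> that contain the index \<open>i\<close>.\<close>
  have kN: "k * N = 4 * \<mu> * \<rho>"
  proof -
    have "\<pi> * u0^2 = \<mu> * (X01 * X02 * X03)"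
      unfolding X(3)[symmetric] u0_def \<mu>_def by (simp add: power2_eq_square)
    moreover have "\<pi> * u1^2 = \<mu> * (X01 * X13 * X12)"
      unfolding X(2)[symmetric] u1_def \<mu>_def by (simp add: power2_eq_square)
    moreover have "\<pi> * u2^2 = \<mu> * (X23 * X02 * X12)"
      unfolding X(1)[symmetric] u2_def \<mu>_def by (simp add: power2_eq_square)
    moreover have "\<pi> * u3^2 = \<mu> * (X23 * X13 * X03)"
    proof -
      have "\<pi> * u3^2 = (X01 * X23) * (X02 * X13) * (X03 * X12)"
        unfolding u3_def X by (simp add: power2_eq_square)
      then show ?thesis by (simp add: \<mu>_def)
    qed
    ultimately have "\<pi> * N = \<mu> * (X01 * X02 * X03 + X01 * X13 * X12 + X23 * X02 * X12 + X23 * X13 * X03)"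
      by (simp add: N_def distrib_left)
    also have "\<dots> = \<mu> * (4 * (a * b * c + a' * b' * c'))"
      by (simp add: X01_def X23_def X02_def X13_def X03_def X12_def algebra_simps)
    also have "\<dots> = (B1 * B2 * B3 + A1 * A2 * A3) * (4 * \<mu> * \<rho>)"
      by (simp add: a_def b_def c_def a'_def b'_def c'_def \<rho>_def algebra_simps)
    finally show ?thesis using k(3) by (simp add: \<pi>_def)
  qed
  have N_nz: "N \<noteq> 0" using kN k(2) \<open>\<mu> \<noteq> 0\<close> nz(1) by (auto simp: \<rho>_def)
  have q0_sq: "q0^2 = x^2 * (4 * N)"
  proof -
    have "q0^2 = N + 2 * (u0 * u1 + u0 * u2 + u0 * u3 + u1 * u2 + u1 * u3 + u2 * u3)"
      unfolding q0_def N_def by (simp add: algebra_simps power2_eq_square)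
    also have "\<dots> = N + 4 * \<mu> * (a + b + c)"
      unfolding uu by (simp add: X01_def X23_def X02_def X13_def X03_def X12_def algebra_simps)
    finally have "k * q0^2 = k * N + 4 * \<mu> * (k * (a + b + c))" by (simp add: algebra_simps)
    also have "k * (a + b + c) = \<rho> * (4 * x^2 - 1)" using root by (simp add: a_def b_def c_def \<rho>_def)
    also have "k * N + 4 * \<mu> * (\<rho> * (4 * x^2 - 1)) = 4 * x^2 * (4 * \<mu> * \<rho>)"
      unfolding kN by (simp add: algebra_simps)
    also have "\<dots> = k * (x^2 * (4 * N))" unfolding kN[symmetric] by simp
    finally show ?thesis using k(2) by simp
  qed
  then have "q0 \<noteq> 0" using N_nz nz(2) by auto
  define l where "l = x / q0"
  have x: "x = l * q0" using \<open>q0 \<noteq> 0\<close> by (simp add: l_def)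
  have "F1 A1 B1 x (l * q1) (l * q2) (l * q3) = l^2 * F1 A1 B1 q0 q1 q2 q3"
    "F2 A2 B2 x (l * q1) (l * q2) (l * q3) = l^2 * F2 A2 B2 q0 q1 q2 q3"
    "F3 A3 B3 x (l * q1) (l * q2) (l * q3) = l^2 * F3 A3 B3 q0 q1 q2 q3"
    unfolding x F1_def F2_def F3_def by (simp_all add: algebra_simps power2_eq_square)
  moreover have "F4 x (l * q1) (l * q2) (l * q3) = l^2 * (q0^2 + q1^2 + q2^2 + q3^2) - 1"
    unfolding x F4_def by (simp add: algebra_simps power2_eq_square)
  moreover have "l^2 * (q0^2 + q1^2 + q2^2 + q3^2) = 1"
  proof -
    have "l^2 * (q0^2 + q1^2 + q2^2 + q3^2) = l^2 * (4 * N)" by (simp only: norm)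
    also have "\<dots> = 1" unfolding l_def power_divide q0_sq using nz(2) N_nz by simp
    finally show ?thesis .
  qed
  ultimately show ?thesis using f1 f2 f3 by (intro exI[of _ "l * q1"] exI[of _ "l * q2"] exI[of _ "l * q3"]) simp
qed

section \<open>The determinant for generic parameters\<close>

text \<open>Nonvanishing of this polynomial is what the comparison of roots needs: the solutions
  constructed above exist, the constant term is nonzero, the four numbers \<open>\<sigma>\<close> are distinct (their
  pairwise differences are \<open>2 (\<plusminus> a \<plusminus> b)\<close> and so on), and none of them is zero (their product is the
  last factor).\<close>

definition generic_params :: "complex \<Rightarrow> complex \<Rightarrow> complex \<Rightarrow> complex \<Rightarrow> complex \<Rightarrow> complex \<Rightarrow> complex" where
  "generic_params A1 A2 A3 B1 B2 B3 =
     (let al = A1^2 * A3^2 + B1^2 * A3^2 + B1^2 * B3^2;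
          be = A1^2 * A2^2 + A1^2 * B2^2 + B1^2 * B2^2;
          ga = A2^2 * A3^2 + A2^2 * B3^2 + B2^2 * B3^2;
          a2 = B1^2 * ga; b2 = B2^2 * al; c2 = B3^2 * be
      in A1 * A2 * A3 * (B1 * B2 * B3 - A1 * A2 * A3) * (B1 * B2 * B3 + A1 * A2 * A3) * (al * be * ga)
         * w3 A1 A2 A3 B1 B2 B3 * ((a2 - b2) * (b2 - c2) * (a2 - c2))
         * (a2^2 + b2^2 + c2^2 - 2*a2*b2 - 2*b2*c2 - 2*a2*c2))"

lemma card_square_roots_of_set:
  assumes "finite Z" "0 \<notin> Z"
  shows "card {x::complex. x^2 \<in> Z} = 2 * card Z"
proof -
  have "{x::complex. x^2 \<in> Z} = (\<Union>z\<in>Z. {x. x^2 = z})" by auto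
  also have "card \<dots> = (\<Sum>z\<in>Z. card {x. x^2 = z})"
  proof (rule card_UN_disjoint)
    show "\<forall>z\<in>Z. finite {x::complex. x^2 = z}"
      by (metis finite_nth_roots zero_less_numeral)
  qed (use assms in auto)
  also have "\<dots> = (\<Sum>z\<in>Z. 2)"
    using assms by (intro sum.cong card_nth_roots) auto
  finally show ?thesis by simp
qed

text \<open>The polynomial \<open>E\<close> is the determinant without the factor \<open>(4 q0^2 - 1)^4\<close>. It has degree at
  most 8 and vanishes at the eight roots of \<open>G\<close>, and \<open>E + s G\<close> also vanishes at 0; nine zeros force
  \<open>E + s G = 0\<close>.\<close>

lemma generic_determinant:
  assumes gen: "generic_params A1 A2 A3 B1 B2 B3 \<noteq> 0"
    and s: "s = 1 \<or> s = -1"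
    and det0: "det (dixon_mat A1 A2 A3 B1 B2 B3 0) = s * (65536 * (w3 A1 A2 A3 B1 B2 B3)^2)"
  shows "det (system_Dix A1 A2 A3 B1 B2 B3) = smult (-s) ([:-1, 2:] ^ 4 * [:1, 2:] ^ 4 * G A1 A2 A3 B1 B2 B3)"
proof -
  let ?D = "det (system_Dix A1 A2 A3 B1 B2 B3)" and ?G = "G A1 A2 A3 B1 B2 B3"
  define al be ga where "al = A1^2 * A3^2 + B1^2 * A3^2 + B1^2 * B3^2" and
    "be = A1^2 * A2^2 + A1^2 * B2^2 + B1^2 * B2^2" and
    "ga = A2^2 * A3^2 + A2^2 * B3^2 + B2^2 * B3^2"
  define r1 r2 r3 where "r1 = csqrt al" and "r2 = csqrt be" and "r3 = csqrt ga"
  have r: "r1^2 = al" "r2^2 = be" "r3^2 = ga" by (simp_all add: r1_def r2_def r3_def)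
  define a b c where "a = B1 * r3" and "b = B2 * r1" and "c = B3 * r2"
  have abc: "a^2 = B1^2 * ga" "b^2 = B2^2 * al" "c^2 = B3^2 * be"
    unfolding a_def b_def c_def power_mult_distrib r by simp_all
  define k where "k = B1 * B2 * B3 - A1 * A2 * A3"
  define \<rho> where "\<rho> = r1 * r2 * r3"
  note gen' = gen[unfolded generic_params_def Let_def, folded al_def be_def ga_def, folded abc]
  have nz: "k \<noteq> 0" "B1 * B2 * B3 + A1 * A2 * A3 \<noteq> 0" "w3 A1 A2 A3 B1 B2 B3 \<noteq> 0" "\<rho> \<noteq> 0"
    using gen' r by (auto simp: k_def \<rho>_def)
  have dist: "a^2 \<noteq> b^2" "b^2 \<noteq> c^2" "a^2 \<noteq> c^2" using gen' by auto
  have heron: "(a + b + c) * (- a - b + c) * (a - b - c) * (- a + b - c) \<noteq> 0"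
  proof -
    have "(a + b + c) * (- a - b + c) * (a - b - c) * (- a + b - c) =
      (a^2)^2 + (b^2)^2 + (c^2)^2 - 2*a^2*b^2 - 2*b^2*c^2 - 2*a^2*c^2"
      by (simp add: algebra_simps power_numeral_reduce)
    then show ?thesis using gen' by simp
  qed
  define Z where "Z = (\<lambda>\<sigma>. (1 + k * \<sigma> / \<rho>) / 4) ` {a + b + c, - a - b + c, a - b - c, - a + b - c}"
  have Z_G: "poly ?G x = 0 \<longleftrightarrow> x^2 \<in> Z" for x
  proof -
    have lin: "\<rho> * (4 * x^2 - 1) - k * \<sigma> = 0 \<longleftrightarrow> x^2 = (1 + k * \<sigma> / \<rho>) / 4" for \<sigma>
      using nz(4) by (auto simp: field_simps)
    have "poly ?G x = 0 \<longleftrightarrow> (\<rho> * (4 * x^2 - 1) - k * (a + b + c)) * (\<rho> * (4 * x^2 - 1) - k * (- a - b + c)) *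
        (\<rho> * (4 * x^2 - 1) - k * (a - b - c)) * (\<rho> * (4 * x^2 - 1) - k * (- a + b - c)) = 0"
      unfolding poly_G quartic_form_factored[OF r[unfolded al_def be_def ga_def] k_def] a_def b_def c_def \<rho>_def
      by simp
    then show ?thesis unfolding mult_eq_0_iff lin Z_def by auto
  qed
  have G0: "poly ?G 0 = - 65536 * (w3 A1 A2 A3 B1 B2 B3)^2"
    by (simp add: G_def Let_def poly_monom)
  then have Z0: "0 \<notin> Z" using Z_G[of 0] nz(3) by simp
  have cardZ: "card Z = 4"
  proof -
    have "card {a + b + c, - a - b + c, a - b - c, - a + b - c} = 4"
    proof -
      have "a + b \<noteq> 0" "a - b \<noteq> 0" "b + c \<noteq> 0" "b - c \<noteq> 0" "a + c \<noteq> 0" "a - c \<noteq> 0"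
        using dist by (auto simp: power2_eq_iff add_eq_0_iff)
      moreover have "u * 2 + v * 2 \<noteq> 0" if "u + v \<noteq> 0" for u v :: complex
        using that by (metis distrib_right mult_eq_0_iff zero_neq_numeral)
      ultimately have "a + b + c \<noteq> - a - b + c" "a + b + c \<noteq> a - b - c" "a + b + c \<noteq> - a + b - c"
        "- a - b + c \<noteq> a - b - c" "- a - b + c \<noteq> - a + b - c" "a - b - c \<noteq> - a + b - c"
        by (auto simp: field_simps)
      then show ?thesis by simp
    qed
    moreover have "inj_on (\<lambda>\<sigma>. (1 + k * \<sigma> / \<rho>) / 4) A" for A
      using nz by (auto simp: inj_on_def)
    ultimately show ?thesis unfolding Z_def by (simp only: card_image)
  qed
  have D0: "poly ?D x = 0" if "x^2 \<in> Z" for x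
  proof -
    have "x \<noteq> 0" using that Z0 by auto
    \<comment> \<open>Changing two signs among \<open>r1, r2, r3\<close> keeps the product and realises each of the four \<open>\<sigma>\<close>.\<close>
    have *: "poly ?D x = 0" if r': "r1'^2 = al" "r2'^2 = be" "r3'^2 = ga" "r1' * r2' * r3' = \<rho>"
      "x^2 = (1 + k * (B1 * r3' + B2 * r1' + B3 * r2') / \<rho>) / 4" for r1' r2' r3'
    proof -
      have "r1' * r2' * r3' * (4 * x^2 - 1) = k * (B1 * r3' + B2 * r1' + B3 * r2')"
        unfolding r'(4,5) using nz(4) by (simp add: field_simps)
      then obtain x1 x2 x3 where "F1 A1 B1 x x1 x2 x3 = 0" "F2 A2 B2 x x1 x2 x3 = 0"
          "F3 A3 B3 x x1 x2 x3 = 0" "F4 x x1 x2 x3 = 0"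
        using solution_from_root[OF r'(1-3)[unfolded al_def be_def ga_def] k_def nz(1,2)] r'(4) nz(4) \<open>x
            \<noteq> 0\<close> by blast
      then show ?thesis unfolding poly_det_system_Dix by (rule det_dixon_mat_eq_0)
    qed
    from that consider "x^2 = (1 + k * (a + b + c) / \<rho>) / 4" | "x^2 = (1 + k * (- a - b + c) / \<rho>) / 4"
      | "x^2 = (1 + k * (a - b - c) / \<rho>) / 4" | "x^2 = (1 + k * (- a + b - c) / \<rho>) / 4"
      unfolding Z_def by blast
    then show ?thesis
    proof cases
      case 1 then show ?thesis using *[of r1 r2 r3] r by (simp add: a_def b_def c_def \<rho>_def)
    next
      case 2 then show ?thesis using *[of "- r1" r2 "- r3"] r by (simp add: a_def b_def c_def \<rho>_def)
    next
      case 3 then show ?thesis using *[of "- r1" "- r2" r3] r by (simp add: a_def b_def c_def \<rho>_def)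
    next
      case 4 then show ?thesis using *[of r1 "- r2" "- r3"] r by (simp add: a_def b_def c_def \<rho>_def)
    qed
  qed
  define K where "K = [:-1, 0, 4::complex:]"
  have "K ^ 4 dvd ?D"
  proof -
    have "4 * [:0, 1::complex:]^2 - 1 = K" by (simp add: K_def power2_eq_square numeral_poly one_pCons)
    then show ?thesis using quadratic_factor_dvd_det[of "[:0, 1:]" "[:A1:]" "[:A2:]" "[:A3:]" "[:B1:]"
        "[:B2:]" "[:B3:]"]
      by (simp add: system_Dix_eq)
  qed
  then obtain E where E: "?D = K ^ 4 * E" by (auto simp: dvd_def)
  have K: "poly K x = 4 * x^2 - 1" for x by (simp add: K_def power2_eq_square)
  have E0: "poly E 0 = s * (65536 * (w3 A1 A2 A3 B1 B2 B3)^2)"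
    using det0 unfolding poly_det_system_Dix[symmetric] E by (simp add: K)
  have "degree E \<le> 8"
  proof (cases "E = 0")
    case False
    have "K \<noteq> 0" "degree K = 2" by (simp_all add: K_def)
    then have "degree ?D = 8 + degree E" unfolding E using False by (simp add: degree_mult_eq degree_power_eq)
    then show ?thesis using degree_det_system_Dix[of A1 A2 A3 B1 B2 B3] by simp
  qed simp
  moreover have "degree ?G \<le> 8"
    unfolding G_def Let_def by (intro degree_add_le degree_diff_le) (auto intro: order_trans[OF degree_monom_le])
  ultimately have deg: "degree (E + smult s ?G) \<le> 8"
    by (intro degree_add_le) (auto intro: order_trans[OF degree_smult_le])
  have "E + smult s ?G = 0"
  proof (rule ccontr)
    assume nonzero: "E + smult s ?G \<noteq> 0"
    have "poly (E + smult s ?G) x = 0" if "x \<in> insert 0 {x. x^2 \<in> Z}" for x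
    proof (cases "x = 0")
      case True then show ?thesis by (simp add: E0 G0)
    next
      case False
      then have x: "x^2 \<in> Z" using that by auto
      have "4 * x^2 - 1 \<noteq> 0"
      proof
        assume "4 * x^2 - 1 = 0"
        then have x2: "x^2 = 1 / 4" by (simp add: field_simps)
        show False using x nz heron unfolding Z_def x2 by auto
      qed
      then have "poly E x = 0" using D0[OF x] unfolding E by (simp add: K)
      then show ?thesis using x Z_G by simp
    qed
    then have "insert 0 {x. x^2 \<in> Z} \<subseteq> {x. poly (E + smult s ?G) x = 0}" by auto
    then have "card (insert 0 {x. x^2 \<in> Z}) \<le> degree (E + smult s ?G)"
      using card_mono[OF poly_roots_finite[OF nonzero]] card_poly_roots_bound[OF nonzero] by (meson order_trans)
    moreover have "finite Z" using cardZ by (metis card.infinite zero_neq_numeral)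
    moreover from this have "card {x. x^2 \<in> Z} = 8" using card_square_roots_of_set[OF _ Z0] cardZ by simp
    moreover from this have "finite {x. x^2 \<in> Z}" by (metis card.infinite zero_neq_numeral)
    ultimately show False using deg Z0 by simp
  qed
  then have "E = smult (-s) ?G" by (metis add_eq_0_iff2 smult_minus_left)
  moreover have "K ^ 4 = [:-1, 2:] ^ 4 * [:1, 2:] ^ 4"
    unfolding power_mult_distrib[symmetric] K_def by simp
  ultimately show ?thesis unfolding E by (simp add: mult_ac)
qed

section \<open>The determinant for all parameters\<close>

text \<open>Closure properties of this predicate show that both sides of the determinant formula depend
  polynomially on the position along a line in parameter space.\<close>

definition polyfun :: "(complex \<Rightarrow> complex) \<Rightarrow> bool" where
  "polyfun f \<longleftrightarrow> (\<exists>p. \<forall>t. f t = poly p t)"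

lemma polyfun_const: "polyfun (\<lambda>t. c)"
  unfolding polyfun_def by (intro exI[of _ "[:c:]"]) simp

lemma polyfun_linear: "polyfun (\<lambda>t. a + t * b)"
  unfolding polyfun_def by (intro exI[of _ "[:a, b:]"]) simp

lemma polyfun_add: "polyfun f \<Longrightarrow> polyfun g \<Longrightarrow> polyfun (\<lambda>t. f t + g t)"
  unfolding polyfun_def by (metis poly_add)

lemma polyfun_diff: "polyfun f \<Longrightarrow> polyfun g \<Longrightarrow> polyfun (\<lambda>t. f t - g t)"
  unfolding polyfun_def by (metis poly_diff)

lemma polyfun_minus: "polyfun f \<Longrightarrow> polyfun (\<lambda>t. - f t)"
  unfolding polyfun_def by (metis poly_minus)

lemma polyfun_mult: "polyfun f \<Longrightarrow> polyfun g \<Longrightarrow> polyfun (\<lambda>t. f t * g t)"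
  unfolding polyfun_def by (metis poly_mult)

lemma polyfun_power: "polyfun f \<Longrightarrow> polyfun (\<lambda>t. f t ^ n)"
  unfolding polyfun_def by (metis poly_power)

lemma polyfun_det_dixon_mat:
  "polyfun (\<lambda>t. det (dixon_mat (a1 + t * a1') (a2 + t * a2') (a3 + t * a3') (b1 + t * b1') (b2
      + t * b2') (b3 + t * b3') x))"
proof -
  let ?p = "det (dixon_mat [:a1, a1':] [:a2, a2':] [:a3, a3':] [:b1, b1':] [:b2, b2':] [:b3, b3':] [:x:])"
  show ?thesis unfolding polyfun_def
    by (rule exI[of _ ?p]) (simp add: det_dixon_mat_hom[OF comm_ring_hom_poly])
qed

lemmas polyfun_intros = polyfun_const polyfun_linear polyfun_add polyfun_diff polyfun_minus polyfun_mult
  polyfun_power polyfun_det_dixon_mat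

text \<open>A polynomial identity that holds wherever a nonzero polynomial \<open>g\<close> does not vanish holds
  everywhere, because \<open>f g = 0\<close>.\<close>

lemma polyfun_eq_zero:
  assumes f: "polyfun f" and g: "polyfun g" and g1: "g t1 \<noteq> 0" and eq: "\<And>t. g t \<noteq> 0 \<Longrightarrow> f t = 0"
  shows "f t = 0"
proof -
  from f g obtain p q where p: "\<And>t. f t = poly p t" and q: "\<And>t. g t = poly q t"
    unfolding polyfun_def by blast
  have "poly (p * q) t = 0" for t using eq[of t] p q by auto
  then have "p * q = 0" by (metis poly_all_0_iff_0)
  moreover have "q \<noteq> 0" using g1 q by auto
  ultimately show ?thesis using p by simp
qed

text \<open>Each parameter vector is joined by a line to \<open>(1, 1, 1, 1, 2, 3)\<close>, which is generic.\<close>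

lemma determinant_formula:
  "\<exists>c::complex. (c = 1 \<or> c = -1) \<and> (\<forall>A1 A2 A3 B1 B2 B3.
     det (system_Dix A1 A2 A3 B1 B2 B3) = smult c ([:-1, 2:] ^ 4 * [:1, 2:] ^ 4 * G A1 A2 A3 B1 B2 B3))"
proof -
  obtain s :: complex where s: "s = 1 \<or> s = -1" and det0: "\<And>A1 A2 A3 B1 B2 B3 :: complex.
     A1 * A2 * A3 \<noteq> 0 \<Longrightarrow> B1 * B2 * B3 - A1 * A2 * A3 \<noteq> 0 \<Longrightarrow>
     det (dixon_mat A1 A2 A3 B1 B2 B3 0) = s * (65536 * (w3 A1 A2 A3 B1 B2 B3)^2)"
    using det_dixon_mat_0 by blast
  let ?rhs = "\<lambda>A1 A2 A3 B1 B2 B3. smult (-s) ([:-1, 2:] ^ 4 * [:1, 2:] ^ 4 * G A1 A2 A3 B1 B2 B3)"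
  have generic: "det (system_Dix A1 A2 A3 B1 B2 B3) = ?rhs A1 A2 A3 B1 B2 B3"
    if "generic_params A1 A2 A3 B1 B2 B3 \<noteq> 0" for A1 A2 A3 B1 B2 B3
    using that by (intro generic_determinant s det0) (auto simp: generic_params_def Let_def)
  have "det (system_Dix A1 A2 A3 B1 B2 B3) = ?rhs A1 A2 A3 B1 B2 B3" for A1 A2 A3 B1 B2 B3
  proof -
    have "poly (det (system_Dix A1 A2 A3 B1 B2 B3)) x = poly (?rhs A1 A2 A3 B1 B2 B3) x" for x
    proof -
    define f where "f t = det (dixon_mat (A1 + t * (1 - A1)) (A2 + t * (1 - A2)) (A3 + t * (1 - A3))
        (B1 + t * (1 - B1)) (B2 + t * (2 - B2)) (B3 + t * (3 - B3)) x)
      - (-s) * ((2 * x - 1) ^ 4 * (2 * x + 1) ^ 4 * (- 65536 * quartic_form (A1 + t * (1 - A1)) (A2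
          + t * (1 - A2)) (A3 + t * (1 - A3))
        (B1 + t * (1 - B1)) (B2 + t * (2 - B2)) (B3 + t * (3 - B3)) (4 * x^2 - 1)))" for t
    define g where "g t = generic_params (A1 + t * (1 - A1)) (A2 + t * (1 - A2)) (A3 + t * (1 - A3))
        (B1 + t * (1 - B1)) (B2 + t * (2 - B2)) (B3 + t * (3 - B3))" for t
    have "polyfun f" unfolding f_def quartic_form_def Let_def by (intro polyfun_intros)
    moreover have "polyfun g" unfolding g_def generic_params_def w3_def Let_def by (intro polyfun_intros)
    moreover have "g 1 \<noteq> 0" by (simp add: g_def generic_params_def w3_def)
    moreover have "f t = 0" if "g t \<noteq> 0" for t
      using arg_cong[OF generic[OF that[unfolded g_def]], of "\<lambda>p. poly p x"]
      unfolding poly_det_system_Dix by (simp add: f_def poly_G algebra_simps)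
    ultimately have "f 0 = 0" by (rule polyfun_eq_zero)
    then show ?thesis
      unfolding poly_det_system_Dix by (simp add: f_def poly_G algebra_simps)
    qed
    then show ?thesis by (intro poly_eq_poly_eq_iff[THEN iffD1] ext)
  qed
  then show ?thesis using s by (intro exI[of _ "-s"]) auto
qed

section \<open>Solvability in radicals\<close>

lemma subfield_closed:
  assumes K: "is_subfield K"
  shows "0 \<in> K" "1 \<in> K" "x \<in> K \<Longrightarrow> y \<in> K \<Longrightarrow> x - y \<in> K" "x \<in> K \<Longrightarrow> y \<in> K \<Longrightarrow> x * y \<in> K"
    "x \<in> K \<Longrightarrow> - x \<in> K" "x \<in> K \<Longrightarrow> y \<in> K \<Longrightarrow> x + y \<in> K" "x \<in> K \<Longrightarrow> y \<in> K \<Longrightarrow> x / y \<in> K"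
    "x \<in> K \<Longrightarrow> x ^ n \<in> K"
proof -
  show one: "1 \<in> K" using K by (simp add: is_subfield_def)
  show diff: "x - y \<in> K" and mult: "x * y \<in> K" if "x \<in> K" "y \<in> K" for x y
    using K that unfolding is_subfield_def by blast+
  show zero: "0 \<in> K" using diff[OF one one] by simp
  show minus: "- x \<in> K" if "x \<in> K" for x using diff[of 0 x] zero that by simp
  show "x + y \<in> K" if "x \<in> K" "y \<in> K" using diff[of x "- y"] minus that by simp
  show "x / y \<in> K" if "x \<in> K" "y \<in> K"
    using mult[of x "inverse y"] that K unfolding is_subfield_def by (simp add: divide_inverse)
  show "x ^ n \<in> K" if "x \<in> K" using that one mult by (induction n) auto
qed

lemma subfield_of_nat: "is_subfield K \<Longrightarrow> of_nat n \<in> K"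
  by (induction n) (auto intro: subfield_closed)

lemma subfield_numeral: "is_subfield K \<Longrightarrow> numeral n \<in> K"
  using subfield_of_nat[of K "numeral n"] by simp

lemma is_subfield_gen_subfield: "is_subfield (gen_subfield S)"
  unfolding gen_subfield_def is_subfield_def by blast

lemma gen_subfield_superset: "S \<subseteq> gen_subfield S"
  unfolding gen_subfield_def by blast

lemma radical_ext_square_root:
  assumes L: "radical_ext K L" "is_subfield L" and z: "z \<in> L"
  obtains L' where "radical_ext K L'" "is_subfield L'" "L \<subseteq> L'" "csqrt z \<in> L'"
proof
  show "radical_ext K (gen_subfield (insert (csqrt z) L))"
    by (rule radical_ext.step[OF L(1), of 2]) (use z in simp_all)
  show "is_subfield (gen_subfield (insert (csqrt z) L))" by (rule is_subfield_gen_subfield)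
  show "L \<subseteq> gen_subfield (insert (csqrt z) L)" "csqrt z \<in> gen_subfield (insert (csqrt z) L)"
    using gen_subfield_superset[of "insert (csqrt z) L"] by auto
qed

text \<open>Only square roots are adjoined in what follows: first those of the three factors of \<open>w\<close>, then
  those of the four values of \<open>q0^2\<close>.\<close>

lemma radical_ext_square_roots:
  assumes "radical_ext K L" "is_subfield L" "set zs \<subseteq> L"
  obtains L' where "radical_ext K L'" "is_subfield L'" "L \<subseteq> L'" "csqrt ` set zs \<subseteq> L'"
  using assms
proof (induction zs arbitrary: thesis L)
  case Nil
  then show ?case by (metis empty_subsetI image_empty list.set(1) subset_refl)
next
  case (Cons z zs)
  obtain L' where L': "radical_ext K L'" "is_subfield L'" "L \<subseteq> L'" "csqrt z \<in> L'"
    using radical_ext_square_root[of K L z] Cons.prems by auto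
  have "set zs \<subseteq> L'" using Cons.prems L'(3) by auto
  from Cons.IH[OF _ L'(1,2) this] obtain L'' where "radical_ext K L''" "is_subfield L''" "L' \<subseteq> L''"
      "csqrt ` set zs \<subseteq> L''"
    by blast
  then show ?case using L' by (intro Cons.prems(1)[of L'']) auto
qed

definition over :: "'a::comm_ring_1 set \<Rightarrow> 'a poly \<Rightarrow> bool" where
  "over K p \<longleftrightarrow> (\<forall>i. coeff p i \<in> K)"

lemma over_intros:
  fixes K :: "'a::field set"
  assumes K: "is_subfield K"
  shows "over K 0" "c \<in> K \<Longrightarrow> over K p \<Longrightarrow> over K (pCons c p)" "c \<in> K \<Longrightarrow> over K (monom c n)"
    "over K p \<Longrightarrow> over K q \<Longrightarrow> over K (p + q)" "over K p \<Longrightarrow> over K q \<Longrightarrow> over K (p - q)"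
    "over K p \<Longrightarrow> over K q \<Longrightarrow> over K (p * q)" "c \<in> K \<Longrightarrow> over K p \<Longrightarrow> over K (smult c p)"
    "over K p \<Longrightarrow> over K (p ^ n)"
proof -
  note closed = subfield_closed[OF K]
  have sum: "(\<Sum>i\<in>A. f i) \<in> K" if "\<And>i. f i \<in> K" for f :: "nat \<Rightarrow> 'a" and A
    using that by (induction A rule: infinite_finite_induct) (auto intro: closed)
  show mult: "over K (p * q)" if "over K p" "over K q" for p q
    using that unfolding over_def coeff_mult by (auto intro: sum closed)
  show "over K (p ^ n)" if "over K p"
  proof (induction n)
    case 0
    show ?case using closed by (simp add: over_def coeff_1)
  next
    case (Suc n)
    then show ?case using mult[OF that] by simp
  qed
qed (use subfield_closed[OF K] in \<open>auto simp: over_def coeff_pCons split: nat.split\<close>)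

lemma over_system_polynomial:
  assumes K: "is_subfield K" and "{A1, A2, A3, B1, B2, B3} \<subseteq> K" and "c \<in> K"
  shows "over K (smult c ([:-1, 2:] ^ 4 * [:1, 2:] ^ 4 * G A1 A2 A3 B1 B2 B3))"
proof -
  note closed = subfield_closed[OF K] subfield_numeral[OF K]
  have params: "A1 \<in> K" "A2 \<in> K" "A3 \<in> K" "B1 \<in> K" "B2 \<in> K" "B3 \<in> K" using assms(2) by auto
  show ?thesis
    unfolding G_def Let_def w_def w1_def w2_def w3_def
    by (intro over_intros[OF K] closed params assms(3))
qed

lemma square_eq_csqrt: "x^2 = z \<Longrightarrow> x = csqrt z \<or> x = - csqrt z"
  by (metis power2_csqrt power2_eq_iff)

text \<open>By the factorisation of \<open>G\<close>, a root outside \<open>\<plusminus> 1/2\<close> satisfies \<open>\<rho> (4 x^2 - 1) = k \<sigma>\<close> with \<open>\<rho>\<close>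
  and \<open>\<sigma>\<close> in the field generated by \<open>r1, r2, r3\<close>. If \<open>\<rho> = 0\<close>, then \<open>G\<close> is constant, and a root would
  make it, and with it \<open>D\<close>, zero.\<close>

lemma system_polynomial_solvable:
  assumes D: "D = smult c ([:-1, 2:] ^ 4 * [:1, 2:] ^ 4 * G A1 A2 A3 B1 B2 B3)" and c: "c = 1 \<or> c = -1"
    and "D \<noteq> 0"
  shows "solvable_in_radicals (gen_subfield {A1, A2, A3, B1, B2, B3}) D"
proof -
  define K where "K = gen_subfield {A1, A2, A3, B1, B2, B3}"
  have K: "is_subfield K" unfolding K_def by (rule is_subfield_gen_subfield)
  have params_sub: "{A1, A2, A3, B1, B2, B3} \<subseteq> K" unfolding K_def by (rule gen_subfield_superset)
  then have params: "A1 \<in> K" "A2 \<in> K" "A3 \<in> K" "B1 \<in> K" "B2 \<in> K" "B3 \<in> K" by auto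
  have "c \<in> K" using c by (auto intro: subfield_closed[OF K])
  then have coeffs: "\<forall>i. coeff D i \<in> K"
    using over_system_polynomial[OF K params_sub] unfolding D over_def by blast
  define al be ga where "al = A1^2 * A3^2 + B1^2 * A3^2 + B1^2 * B3^2" and
    "be = A1^2 * A2^2 + A1^2 * B2^2 + B1^2 * B2^2" and
    "ga = A2^2 * A3^2 + A2^2 * B3^2 + B2^2 * B3^2"
  define r1 r2 r3 where "r1 = csqrt al" and "r2 = csqrt be" and "r3 = csqrt ga"
  have r: "r1^2 = al" "r2^2 = be" "r3^2 = ga" by (simp_all add: r1_def r2_def r3_def)
  define k where "k = B1 * B2 * B3 - A1 * A2 * A3"
  define \<rho> where "\<rho> = r1 * r2 * r3"
  define \<sigma>s where "\<sigma>s = [B1 * r3 + B2 * r1 + B3 * r2, - B1 * r3 - B2 * r1 + B3 * r2,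
     B1 * r3 - B2 * r1 - B3 * r2, - B1 * r3 + B2 * r1 - B3 * r2]"
  have G_fact: "poly (G A1 A2 A3 B1 B2 B3) x = - 65536 * (\<Prod>\<sigma>\<leftarrow>\<sigma>s. \<rho> * (4 * x^2 - 1) - k * \<sigma>)" for x
    unfolding poly_G quartic_form_factored[OF r[unfolded al_def be_def ga_def] k_def] \<rho>_def \<sigma>s_def
    by simp
  have "set [al, be, ga] \<subseteq> K"
    unfolding al_def be_def ga_def using params by (auto intro!: subfield_closed[OF K])
  then obtain L where L: "radical_ext K L" "is_subfield L" "K \<subseteq> L" "csqrt ` set [al, be, ga] \<subseteq> L"
    using radical_ext_square_roots[OF radical_ext.refl K, of "[al, be, ga]"] by blast
  note closed = subfield_closed[OF L(2)] subfield_numeral[OF L(2)]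
  have in_L: "A1 \<in> L" "A2 \<in> L" "A3 \<in> L" "B1 \<in> L" "B2 \<in> L" "B3 \<in> L" "r1 \<in> L" "r2 \<in> L" "r3 \<in> L"
    using params L(3,4) by (auto simp: r1_def r2_def r3_def)
  define z where "z \<sigma> = (1 + k * \<sigma> / \<rho>) / 4" for \<sigma>
  have "\<sigma> \<in> L" if "\<sigma> \<in> set \<sigma>s" for \<sigma>
    using that in_L unfolding \<sigma>s_def by (auto intro!: closed)
  then have "set (map z \<sigma>s) \<subseteq> L"
    unfolding z_def k_def \<rho>_def using in_L by (auto intro!: closed)
  then obtain L' where L': "radical_ext K L'" "is_subfield L'" "L \<subseteq> L'" "csqrt ` set (map z \<sigma>s) \<subseteq> L'"
    using radical_ext_square_roots[OF L(1,2)] by blast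
  have "x \<in> L'" if x: "poly D x = 0" for x
  proof -
    note closed' = subfield_closed[OF L'(2)] subfield_numeral[OF L'(2)]
    have "(2 * x - 1 = 0 \<or> 2 * x + 1 = 0) \<or> poly (G A1 A2 A3 B1 B2 B3) x = 0"
      using x c unfolding D by (auto simp: algebra_simps)
    then consider "x = 1 / 2" | "x = - (1 / 2)" | "poly (G A1 A2 A3 B1 B2 B3) x = 0"
      by (auto simp: field_simps add_eq_0_iff)
    then show ?thesis
    proof cases
      case 1
      show ?thesis unfolding 1 by (intro closed')
    next
      case 2
      show ?thesis unfolding 2 by (intro closed')
    next
      case 3
      have "\<rho> \<noteq> 0"
      proof
        assume "\<rho> = 0"
        then have "poly (G A1 A2 A3 B1 B2 B3) y = poly (G A1 A2 A3 B1 B2 B3) x" for y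
          unfolding G_fact by simp
        then have "G A1 A2 A3 B1 B2 B3 = 0" using 3 by (metis poly_all_0_iff_0)
        then show False using D \<open>D \<noteq> 0\<close> by simp
      qed
      obtain \<sigma> where \<sigma>: "\<sigma> \<in> set \<sigma>s" "\<rho> * (4 * x^2 - 1) - k * \<sigma> = 0"
        using 3 unfolding G_fact by (auto simp: prod_list_zero_iff)
      then have "x^2 = z \<sigma>" using \<open>\<rho> \<noteq> 0\<close> by (simp add: z_def field_simps)
      then have "x = csqrt (z \<sigma>) \<or> x = - csqrt (z \<sigma>)" by (rule square_eq_csqrt)
      moreover have "csqrt (z \<sigma>) \<in> L'" using \<sigma>(1) L'(4) by auto
      ultimately show ?thesis by (auto intro: closed')
    qed
  qed
  then show ?thesis
    unfolding solvable_in_radicals_def K_def[symmetric] using \<open>D \<noteq> 0\<close> coeffs L'(1) by blast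
qed

section \<open>The main result\<close>

lemma degree_system_polynomial:
  assumes "w A1 A2 A3 B1 B2 B3 \<noteq> 0" "c \<noteq> 0"
  shows "degree (smult c ([:-1, 2:] ^ 4 * [:1, 2:] ^ 4 * G A1 A2 A3 B1 B2 B3)) = 16"
proof -
  let ?G = "G A1 A2 A3 B1 B2 B3"
  have "coeff ?G 8 \<noteq> 0" using assms(1) by (simp add: G_def Let_def)
  moreover have "degree ?G \<le> 8"
    unfolding G_def Let_def by (intro degree_add_le degree_diff_le) (auto intro: order_trans[OF degree_monom_le])
  ultimately have G: "degree ?G = 8" by (meson antisym le_degree)
  then have "?G \<noteq> 0" by auto
  then show ?thesis using assms(2) G by (simp add: degree_mult_eq degree_power_eq)
qed

theorem lemma5:
  shows "(\<exists>c::complex. c \<noteq> 0 \<and>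
           (\<forall>A1 A2 A3 B1 B2 B3 :: complex.
              let D = det (system_Dix A1 A2 A3 B1 B2 B3) in
                (\<forall>s0 s1 s2 s3. is_solution A1 A2 A3 B1 B2 B3 (s0, s1, s2, s3) \<longrightarrow> poly D s0 = 0) \<and>
                (w A1 A2 A3 B1 B2 B3 \<noteq> 0 \<longrightarrow> degree D = 16) \<and>
                (D \<noteq> 0 \<longrightarrow> solvable_in_radicals (gen_subfield {A1, A2, A3, B1, B2, B3}) D) \<and>
                D = smult c ([:-1, 2:] ^ 4 * [:1, 2:] ^ 4 * G A1 A2 A3 B1 B2 B3))) \<and>
         (\<exists>A1 A2 A3 B1 B2 B3. w A1 A2 A3 B1 B2 B3 \<noteq> 0)"
proof
  obtain c :: complex where c: "c = 1 \<or> c = -1" and formula: "\<And>A1 A2 A3 B1 B2 B3.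
     det (system_Dix A1 A2 A3 B1 B2 B3) = smult c ([:-1, 2:] ^ 4 * [:1, 2:] ^ 4 * G A1 A2 A3 B1 B2 B3)"
    using determinant_formula by blast
  have "c \<noteq> 0" using c by auto
  have sol: "poly (det (system_Dix A1 A2 A3 B1 B2 B3)) s0 = 0"
    if "is_solution A1 A2 A3 B1 B2 B3 (s0, s1, s2, s3)" for A1 A2 A3 B1 B2 B3 s0 s1 s2 s3
    using that unfolding is_solution_def poly_det_system_Dix by (auto intro: det_dixon_mat_eq_0)
  have deg: "degree (det (system_Dix A1 A2 A3 B1 B2 B3)) = 16"
    if "w A1 A2 A3 B1 B2 B3 \<noteq> 0" for A1 A2 A3 B1 B2 B3
    unfolding formula using that \<open>c \<noteq> 0\<close> by (rule degree_system_polynomial)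
  have solv: "solvable_in_radicals (gen_subfield {A1, A2, A3, B1, B2, B3}) (det (system_Dix A1 A2 A3 B1 B2 B3))"
    if "det (system_Dix A1 A2 A3 B1 B2 B3) \<noteq> 0" for A1 A2 A3 B1 B2 B3
    using formula c that by (rule system_polynomial_solvable)
  show "\<exists>c::complex. c \<noteq> 0 \<and>
           (\<forall>A1 A2 A3 B1 B2 B3 :: complex.
              let D = det (system_Dix A1 A2 A3 B1 B2 B3) in
                (\<forall>s0 s1 s2 s3. is_solution A1 A2 A3 B1 B2 B3 (s0, s1, s2, s3) \<longrightarrow> poly D s0 = 0) \<and>
                (w A1 A2 A3 B1 B2 B3 \<noteq> 0 \<longrightarrow> degree D = 16) \<and>
                (D \<noteq> 0 \<longrightarrow> solvable_in_radicals (gen_subfield {A1, A2, A3, B1, B2, B3}) D) \<and>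
                D = smult c ([:-1, 2:] ^ 4 * [:1, 2:] ^ 4 * G A1 A2 A3 B1 B2 B3))"
    unfolding Let_def
    by (intro exI[of _ c] conjI allI impI) (fact \<open>c \<noteq> 0\<close> | erule sol | erule deg | erule solv | rule formula)+
  have "w 1 1 1 0 0 0 \<noteq> 0" by (simp add: w_def)
  then show "\<exists>A1 A2 A3 B1 B2 B3. w A1 A2 A3 B1 B2 B3 \<noteq> 0" by blast
qed

end
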